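(* Let $\{S_n\}_{n\ge 0}$ be the SRRW-RVM with memory sequence $\{\mu_n\}$ (regularly varying of index $\gamma>-1$), recollection probability $p\in[0,1]$ and mean zero innovation sequence $\{\xi_n\}$ with $\mathbb{E}(\xi_1^2)=1$. Then: (1) If $\{v_n\}$ is unbounded, then as $n\to\infty$ $$\mathbb{E}S_n^2\sim\begin{cases}\dfrac{2\gamma+1-p}{(1-p)\,(2(1-p)(\gamma+1)-1)}\,n, & \text{if } p\in[0,p_c),\\[2mm] (2\gamma+1)^2\sigma_n^2, & \text{if } p=p_c.\end{cases}$$ (2) If $\{v_n\}$ is bounded, then the sequence $\{a_n\mu_nS_n\}_{n\ge1}$ is $L^2$-bounded, i.e. $\sup_n\mathbb{E}(a_n^2\mu_n^2S_n^2)<\infty$.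
   Context: Model (SRRW-RVM, step reinforced random walk with regularly varying memory). Fix $p\in[0,1]$ (recollection probability) and $\gamma>-1$. Let $\{\mu_n\}_{n\ge1}$ (memory sequence) be a sequence of positive reals, regularly varying of index $\gamma$: $\mu_{\lfloor\lambda n\rfloor}/\mu_n\to\lambda^\gamma$ for every $\lambda>0$. Put $\nu_n=\sum_{k=1}^n\mu_k$. Let $\{\xi_n\}_{n\ge1}$ (innovation sequence) be i.i.d. real random variables with mean $0$; $\{\alpha_n\}_{n\ge2}$ i.i.d. Bernoulli($p$); $\{\beta_n\}_{n\ge2}$ independent with $\mathbb{P}(\beta_n=k)=\mu_k/\nu_{n-1}$ for $1\le k\le n-1$; the three sequences are independent of each other. Set $X_1=\xi_1$ and, for $n\ge1$, $X_{n+1}=\alpha_{n+1}X_{\beta_{n+1}}+(1-\alpha_{n+1})\xi_{n+1}$. The walk is $S_0=0$, $S_n=\sum_{k=1}^nX_k$ for $n\ge1$. Notation. $a_n=\prod_{i=1}^{n-1}\left(1+p\frac{\mu_{i+1}}{\nu_i}\right)^{-1}$ for $n\ge1$ (empty product $=1$, so $a_1=1$); $v_n^2=\sum_{k=1}^na_k^2\mu_k^2$ ($v_n\ge 0$); $\sigma_n=v_n/(a_n\mu_n)$, i.e. $\sigma_n^2=\frac{1}{a_n^2\mu_n^2}\sum_{k=1}^n a_k^2\mu_k^2$; $p_c=(\gamma+\frac12)/(\gamma+1)$. For nonnegative sequences, $x_n\sim y_n$ means $x_n/y_n\to1$.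
   Formalization: For p = p_c = 0 and γ = −1/2 the constant (2γ+1)² is 0, so the stated relation E S_n² ~ 0 fails (E S_n² = n, e.g. μ_n = n^{-1/2}); in this case the theorem proves E S_n²/σ_n² → (2γ+1)² = 0 instead. *)

theory Defs
  imports "HOL-Probability.Probability" "HOL-Library.Landau_Symbols"
begin

text \<open>
  All sequences of the model are indexed from 1 (or 2); their values at smaller indices are
  irrelevant.
\<close>

definition regularly_varying :: "real \<Rightarrow> (nat \<Rightarrow> real) \<Rightarrow> bool" where
  "regularly_varying \<gamma> \<mu> \<longleftrightarrow>
     (\<forall>t>0. (\<lambda>n. \<mu> (nat \<lfloor>t * real n\<rfloor>) / \<mu> n) \<longlonglongrightarrow> t powr \<gamma>)"

definition nu :: "(nat \<Rightarrow> real) \<Rightarrow> nat \<Rightarrow> real" where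
  "nu \<mu> n = (\<Sum>k=1..n. \<mu> k)"

text \<open>
  The step sequence determined by one realisation \<open>x\<close>, \<open>a\<close>, \<open>b\<close> of the innovations, the
  recollection indicators and the recalled times. The test \<open>b (Suc n) \<le> n\<close> only makes the
  recursion well-founded: in the model below it holds almost surely.
\<close>

fun step :: "(nat \<Rightarrow> real) \<Rightarrow> (nat \<Rightarrow> bool) \<Rightarrow> (nat \<Rightarrow> nat) \<Rightarrow> nat \<Rightarrow> real" where
  "step x a b 0 = 0"
| "step x a b (Suc n) =
     (if n = 0 then x 1
      else of_bool (a (Suc n)) * (if b (Suc n) \<le> n then step x a b (b (Suc n)) else 0)
           + (1 - of_bool (a (Suc n))) * x (Suc n))"

definition walk ::
  "(nat \<Rightarrow> 'a \<Rightarrow> real) \<Rightarrow> (nat \<Rightarrow> 'a \<Rightarrow> bool) \<Rightarrow> (nat \<Rightarrow> 'a \<Rightarrow> nat) \<Rightarrow> nat \<Rightarrow> 'a \<Rightarrow> real" where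
  "walk \<xi> \<alpha> \<beta> n \<omega> =
     (\<Sum>k=1..n. step (\<lambda>i. \<xi> i \<omega>) (\<lambda>i. \<alpha> i \<omega>) (\<lambda>i. \<beta> i \<omega>) k)"

text \<open>
  Independence within each of the sequences \<open>\<xi>\<close>, \<open>\<alpha>\<close>, \<open>\<beta>\<close> together with independence between
  the three sequences is joint independence of the whole family. It is stated for the
  disjoint union of the index sets, with \<open>\<alpha>\<close> and \<open>\<beta>\<close> embedded into the reals because
  \<open>indep_vars\<close> needs a common value type; it includes measurability of all the variables.
\<close>

locale srrw_rvm = prob_space M for M :: "'a measure" +
  fixes p \<gamma> :: real and \<mu> :: "nat \<Rightarrow> real"
    and \<xi> :: "nat \<Rightarrow> 'a \<Rightarrow> real" and \<alpha> :: "nat \<Rightarrow> 'a \<Rightarrow> bool" and \<beta> :: "nat \<Rightarrow> 'a \<Rightarrow> nat"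
  assumes p_range: "0 \<le> p" "p \<le> 1"
    and gamma_gt: "\<gamma> > -1"
    and mu_pos: "\<And>n. n \<ge> 1 \<Longrightarrow> \<mu> n > 0"
    and mu_rv: "regularly_varying \<gamma> \<mu>"
    and indep: "indep_vars (\<lambda>_. borel)
          (case_sum \<xi> (case_sum (\<lambda>n \<omega>. of_bool (\<alpha> n \<omega>)) (\<lambda>n \<omega>. real (\<beta> n \<omega>))))
          ({1..} <+> ({2..} <+> {2..}))"
    and xi_ident: "\<And>n. n \<ge> 1 \<Longrightarrow> distr M borel (\<xi> n) = distr M borel (\<xi> 1)"
    and xi_integrable: "integrable M (\<xi> 1)"
    and xi_mean: "expectation (\<xi> 1) = 0"
    and alpha_distr: "\<And>n. n \<ge> 2 \<Longrightarrow>
          distr M (count_space UNIV) (\<alpha> n) = measure_pmf (bernoulli_pmf p)"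
    and beta_distr: "\<And>n k. n \<ge> 2 \<Longrightarrow> 1 \<le> k \<Longrightarrow> k \<le> n - 1 \<Longrightarrow>
          prob {\<omega> \<in> space M. \<beta> n \<omega> = k} = \<mu> k / nu \<mu> (n - 1)"

definition aseq :: "real \<Rightarrow> (nat \<Rightarrow> real) \<Rightarrow> nat \<Rightarrow> real" where
  "aseq p \<mu> n = (\<Prod>i=1..<n. inverse (1 + p * (\<mu> (i + 1) / nu \<mu> i)))"

definition vseq :: "real \<Rightarrow> (nat \<Rightarrow> real) \<Rightarrow> nat \<Rightarrow> real" where
  "vseq p \<mu> n = sqrt (\<Sum>k=1..n. (aseq p \<mu> k)\<^sup>2 * (\<mu> k)\<^sup>2)"

definition sigma :: "real \<Rightarrow> (nat \<Rightarrow> real) \<Rightarrow> nat \<Rightarrow> real" where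
  "sigma p \<mu> n = vseq p \<mu> n / (aseq p \<mu> n * \<mu> n)"

definition p_crit :: "real \<Rightarrow> real" where
  "p_crit \<gamma> = (\<gamma> + 1/2) / (\<gamma> + 1)"

end

(*
  Write Y_n = mu_1 X_1 + ... + mu_n X_n. Given the past, X_{n+1} has mean p Y_n / nu_n and X_n has
  second moment 1, so A_n = E Y_n^2, B_n = E S_n Y_n and C_n = E S_n^2 satisfy a triangular system
  of linear recursions in which the weights enter only through mu_{n+1} / nu_n. By Karamata's
  theorem n mu_n / nu_n tends to gamma + 1, so after normalising by n / nu_n^2, 1 / nu_n and 1 / n
  (when p < p_c), or by powers of a_n nu_n / n and v_n (otherwise), each of the three sequences
  satisfies y_{n+1} = (1 - d_n / n) y_n + f_n / n with d_n -> d > 0. Such a sequence is bounded if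
  f is, and tends to f / d if f_n -> f. The exception is A_n when p = p_c, where a_n^2 A_n / v_n^2
  tends to 1 because a_n Y_n is a martingale.

  Karamata's theorem is derived from the pointwise definition of regular variation, without the
  uniform convergence theorem: Fatou's lemma gives limsup n mu_n / nu_n <= gamma + 1, and an excess
  of (gamma + 1) nu_n / (n mu_n) over 1 would grow geometrically along n, floor (delta n), ...
*)

theory Submission
  imports Defs "HOL-Real_Asymp.Real_Asymp"
begin

section \<open>Linear recursions with coefficients \<open>1 - d n / n\<close>\<close>

text \<open>Pointwise regular variation controls \<open>\<mu>\<close> too weakly for
  \<open>\<mu>\<close> to serve as a normaliser: \<open>\<mu> (Suc n) / \<mu> n - 1\<close> need not
  be of order 1/n. The normalisers are therefore built from n, nu_n and a_n, and from v_n^2 when p =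
  p_c, whose relative increments are rho/n + o(1/n); \<open>\<mu>\<close> itself returns only in the
  source terms, through the convergent n mu_n / nu_n. The sign of 2 (gamma + 1) (1 - p) - 1
  separates the regimes. Below p_c this number is the rate d for A_n. At p_c it vanishes, the
  normalised recursion for A_n has no finite level to settle at, and v_n^2 becomes large against n
  (a_n mu_n)^2. On the scale of v_n^2 the source terms of B_n and C_n are then negligible, and the
  limits come from recollection alone. In Karamata's theorem the upper bound has to come before the
  limit: boundedness of n mu_n / nu_n supplies the integrable majorant for dominated convergence
  that uniform convergence would otherwise give.\<close>

lemma recursion_contract_tendsto_0:
  fixes x :: "nat \<Rightarrow> real"
  assumes c: "c > 0" and x: "\<And>n. n \<ge> 1 \<Longrightarrow> x n \<ge> 0"
    and rec: "\<forall>\<^sub>F n in sequentially. x (Suc n) \<le> (1 - c / real n) * x n"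
  shows "x \<longlonglongrightarrow> 0"
proof -
  obtain N where N: "\<And>n. n \<ge> N \<Longrightarrow> x (Suc n) \<le> (1 - c / real n) * x n" "N \<ge> 1"
    using eventually_conj[OF rec eventually_ge_at_top[of 1]]
    by (auto simp: eventually_sequentially)
  \<comment> \<open>From \<open>1 - t \<le> exp (- t)\<close> the factors multiply to the
    exponential of a multiple of the harmonic sum, whose divergence forces the limit 0.\<close>
  define K where "K = x N * exp (c * (\<Sum>k=1..<N. 1 / real k))"
  have bound: "x n \<le> K * exp (- c * (\<Sum>k=1..<n. 1 / real k))" if "n \<ge> N" for n
    using that
  proof (induction rule: dec_induct)
    case base
    then show ?case by (simp add: K_def exp_add[symmetric] mult.assoc)
  next
    case (step n)
    have "x (Suc n) \<le> (1 - c / real n) * x n" using N step by simp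
    also have "\<dots> \<le> exp (- c / real n) * x n"
      using exp_ge_add_one_self[of "- c / real n"] x[of n] step N
      by (intro mult_right_mono) auto
    also have "\<dots> \<le> exp (- c / real n) * (K * exp (- c * (\<Sum>k=1..<n. 1 / real k)))"
      using step by (intro mult_left_mono) auto
    also have "\<dots> = K * exp (- c * (\<Sum>k=1..<Suc n. 1 / real k))"
      using step N by (simp add: exp_add[symmetric] algebra_simps)
    finally show ?case .
  qed
  have "filterlim (\<lambda>n. \<Sum>k=1..<n. 1 / real k) at_top sequentially"
  proof -
    have "(\<Sum>k=1..<Suc n. 1 / real k) = harm n" for n
      by (simp add: harm_def atLeastLessThanSuc_atLeastAtMost field_simps)
    then show ?thesis
      using harm_at_top by (subst filterlim_sequentially_Suc[symmetric]) simp
  qed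
  then have "filterlim (\<lambda>n. - c * (\<Sum>k=1..<n. 1 / real k)) at_bot sequentially"
    using c by (intro filterlim_tendsto_neg_mult_at_bot[OF tendsto_const]) auto
  then have "(\<lambda>n. exp (- c * (\<Sum>k=1..<n. 1 / real k))) \<longlonglongrightarrow> 0"
    by (rule filterlim_compose[OF exp_at_bot])
  then have lim: "(\<lambda>n. K * exp (- c * (\<Sum>k=1..<n. 1 / real k))) \<longlonglongrightarrow> 0"
    by (rule tendsto_mult_right_zero)
  have lo: "\<forall>\<^sub>F n in sequentially. 0 \<le> x n"
    using eventually_ge_at_top[of 1] by eventually_elim (rule x)
  have up: "\<forall>\<^sub>F n in sequentially. x n \<le> K * exp (- c * (\<Sum>k=1..<n. 1 / real k))"
    using eventually_ge_at_top[of N] by eventually_elim (rule bound)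
  show ?thesis
    by (rule real_tendsto_sandwich[OF lo up tendsto_const lim])
qed

text \<open>The level \<open>f / d\<close> is the common fixed point of all the maps y -> (1 - d/n)
  y + f/n. The positive part of \<open>y n - f / d\<close> hence obeys the homogeneous recursion as
  soon as \<open>n\<close> is at least \<open>d\<close>, when the factor is nonnegative.\<close>

lemma recursion_eventually_less:
  fixes y :: "nat \<Rightarrow> real"
  assumes d: "d > 0"
    and rec: "\<forall>\<^sub>F n in sequentially. y (Suc n) \<le> (1 - d / real n) * y n + f / real n"
    and b: "b > f / d"
  shows "\<forall>\<^sub>F n in sequentially. y n < b"
proof -
  define x where "x n = max 0 (y n - f / d)" for n
  have "x \<longlonglongrightarrow> 0"
  proof (rule recursion_contract_tendsto_0[OF d])
    show "\<forall>\<^sub>F n in sequentially. x (Suc n) \<le> (1 - d / real n) * x n"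
      using rec eventually_ge_at_top[of 1] eventually_ge_at_top[of "nat \<lceil>d\<rceil>"]
    proof eventually_elim
      case (elim n)
      then have dn: "1 - d / real n \<ge> 0" by (simp add: field_simps nat_ceiling_le_eq)
      have "(1 - d / real n) * (y n - f / d) = (1 - d / real n) * y n + f / real n - f / d"
        using elim d by (simp add: field_simps)
      with elim have "y (Suc n) - f / d \<le> (1 - d / real n) * (y n - f / d)"
        by linarith
      also have "\<dots> \<le> (1 - d / real n) * x n"
        using dn by (intro mult_left_mono) (auto simp: x_def)
      finally show ?case
        using dn by (auto simp: x_def)
    qed
  qed (simp add: x_def)
  from order_tendstoD(2)[OF this, of "b - f / d"] b
  show ?thesis by (auto simp: x_def elim: eventually_mono)
qed

lemma recursion_eventually_greater:
  fixes y :: "nat \<Rightarrow> real"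
  assumes d: "d > 0"
    and rec: "\<forall>\<^sub>F n in sequentially. y (Suc n) \<ge> (1 - d / real n) * y n + f / real n"
    and b: "b < f / d"
  shows "\<forall>\<^sub>F n in sequentially. y n > b"
proof -
  have "\<forall>\<^sub>F n in sequentially. - y n < - b"
  proof (rule recursion_eventually_less[OF d])
    show "\<forall>\<^sub>F n in sequentially. - y (Suc n) \<le> (1 - d / real n) * - y n + (- f) / real n"
      using rec by eventually_elim simp
  qed (use b in simp)
  then show ?thesis by simp
qed

text \<open>The distance to \<open>f0 / d0\<close> obeys a recursion of the same kind whose forcing
  \<open>e n\<close> tends to 0, so it drops below every positive level.\<close>

lemma recursion_tendsto:
  fixes y d f :: "nat \<Rightarrow> real"
  assumes d0: "d0 > 0" and d: "d \<longlonglongrightarrow> d0" and f: "f \<longlonglongrightarrow> f0"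
    and rec: "\<forall>\<^sub>F n in sequentially. y (Suc n) = (1 - d n / real n) * y n + f n / real n"
  shows "y \<longlonglongrightarrow> f0 / d0"
proof -
  define x where "x n = \<bar>y n - f0 / d0\<bar>" for n
  define e where "e n = f n - d n * (f0 / d0)" for n
  have "(\<lambda>n. f n - d n * (f0 / d0)) \<longlonglongrightarrow> f0 - d0 * (f0 / d0)"
    by (intro tendsto_intros d f)
  then have e: "e \<longlonglongrightarrow> 0" using d0 by (simp add: e_def[abs_def])
  have shift: "Y - c = (1 - D / N) * (z - c) + (F - D * c) / N"
    if "Y = (1 - D / N) * z + F / N" for Y D N z F c :: real
    using that by (simp add: algebra_simps diff_divide_distrib)
  have "\<forall>\<^sub>F n in sequentially. x n < b" if b: "b > 0" for b
  \<comment> \<open>Rate \<open>d0 / 2\<close> and forcing \<open>b * d0 / 4\<close> give the level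
    \<open>b / 2\<close>, strictly below the target \<open>b\<close>.\<close>
  proof (rule recursion_eventually_less[where d = "d0 / 2" and f = "b * d0 / 4"])
    have "\<forall>\<^sub>F n in sequentially. \<bar>e n\<bar> < b * d0 / 4"
      using order_tendstoD(2)[OF tendsto_rabs_zero[OF e], of "b * d0 / 4"] b d0 by simp
    moreover have "\<forall>\<^sub>F n in sequentially. d n > d0 / 2" "\<forall>\<^sub>F n in sequentially. d n < d0 + 1"
      using order_tendstoD(1)[OF d, of "d0 / 2"] order_tendstoD(2)[OF d, of "d0 + 1"] d0 by simp_all
    ultimately show "\<forall>\<^sub>F n in sequentially. x (Suc n) \<le> (1 - d0 / 2 / real n) * x n + b * d0 / 4 / real n"
      using rec eventually_ge_at_top[of 1] eventually_ge_at_top[of "nat \<lceil>d0\<rceil> + 1"]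
    proof eventually_elim
      case (elim n)
      have "real (nat \<lceil>d0\<rceil> + 1) \<le> real n" using elim by (simp only: of_nat_le_iff)
      then have n: "real n \<ge> d n" "real n > 0"
        using elim real_nat_ceiling_ge[of d0] by simp_all
      have "y (Suc n) - f0 / d0 = (1 - d n / real n) * (y n - f0 / d0) + e n / real n"
        unfolding e_def by (rule shift[OF elim(4)])
      then have "x (Suc n) \<le> \<bar>1 - d n / real n\<bar> * x n + \<bar>e n\<bar> / real n"
        unfolding x_def by (metis abs_mult abs_divide abs_of_nat abs_triangle_ineq)
      also have "\<bar>1 - d n / real n\<bar> = 1 - d n / real n"
        using n by simp
      also have "(1 - d n / real n) * x n \<le> (1 - d0 / 2 / real n) * x n"
        using elim n by (intro mult_right_mono diff_left_mono divide_right_mono) (auto simp: x_def)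
      also have "\<bar>e n\<bar> / real n \<le> b * d0 / 4 / real n"
        using elim n by (intro divide_right_mono) auto
      finally show ?case by simp
    qed
  qed (use d0 b in auto)
  then have "x \<longlonglongrightarrow> 0"
    by (intro order_tendstoI) (auto simp: x_def elim: order_less_le_trans intro!: always_eventually)
  then have "(\<lambda>n. y n - f0 / d0) \<longlonglongrightarrow> 0"
    unfolding x_def by (simp add: tendsto_rabs_zero_iff)
  then show ?thesis by (simp add: LIM_zero_iff)
qed

text \<open>Nonnegativity of \<open>y\<close> allows the variable rate \<open>d n\<close> to be
  lowered to the constant \<open>d0 / 2\<close> inside the inequality; the finitely many early terms
  enter through a maximum.\<close>

lemma recursion_bounded:
  fixes y d :: "nat \<Rightarrow> real"
  assumes d0: "d0 > 0" and d: "d \<longlonglongrightarrow> d0" and y: "\<And>n. n \<ge> 1 \<Longrightarrow> y n \<ge> 0"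
    and rec: "\<forall>\<^sub>F n in sequentially. y (Suc n) \<le> (1 - d n / real n) * y n + f / real n"
  obtains b where "\<And>n. n \<ge> 1 \<Longrightarrow> y n \<le> b"
proof -
  have "\<forall>\<^sub>F n in sequentially. y n < f / (d0 / 2) + 1"
  proof (rule recursion_eventually_less[where d = "d0 / 2" and f = f])
    have "\<forall>\<^sub>F n in sequentially. d n > d0 / 2"
      using order_tendstoD(1)[OF d, of "d0 / 2"] d0 by simp
    then show "\<forall>\<^sub>F n in sequentially. y (Suc n) \<le> (1 - d0 / 2 / real n) * y n + f / real n"
      using rec eventually_ge_at_top[of 1]
    proof eventually_elim
      case (elim n)
      have "(1 - d n / real n) * y n \<le> (1 - d0 / 2 / real n) * y n"
        using elim y[of n] by (intro mult_right_mono diff_left_mono divide_right_mono) auto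
      with elim show ?case by linarith
    qed
  qed (use d0 in auto)
  then obtain N where N: "\<And>n. n \<ge> N \<Longrightarrow> y n < f / (d0 / 2) + 1"
    by (auto simp: eventually_sequentially)
  define b where "b = Max (insert (f / (d0 / 2) + 1) (y ` {..<N}))"
  have "y n \<le> b" for n
  proof (cases "n < N")
    case True then show ?thesis unfolding b_def by (intro Max_ge) auto
  next
    case False
    then have "y n \<le> f / (d0 / 2) + 1" using N[of n] by auto
    also have "\<dots> \<le> b" unfolding b_def by (intro Max_ge) auto
    finally show ?thesis .
  qed
  then show ?thesis by (rule that)
qed

section \<open>Sequences with an index, and linear recursions normalised by them\<close>

text \<open>A difference form of regular variation with index \<open>\<rho>\<close>, stronger than the definition by ratios.\<close>
definition has_index :: "(nat \<Rightarrow> real) \<Rightarrow> real \<Rightarrow> bool" where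
  "has_index x \<rho> \<longleftrightarrow> (\<forall>n\<ge>1. x n > 0) \<and> (\<lambda>n. real n * (x (Suc n) / x n - 1)) \<longlonglongrightarrow> \<rho>"

lemma has_index_pos: "has_index x \<rho> \<Longrightarrow> n \<ge> 1 \<Longrightarrow> x n > 0"
  by (simp add: has_index_def)

lemma tendsto_of_scaled:
  fixes c :: "nat \<Rightarrow> real"
  assumes "(\<lambda>n. real n * c n) \<longlonglongrightarrow> l"
  shows "c \<longlonglongrightarrow> 0"
proof -
  have "(\<lambda>n. (real n * c n) * (1 / real n)) \<longlonglongrightarrow> l * 0"
    by (intro tendsto_mult assms lim_1_over_n)
  moreover have "\<forall>\<^sub>F n in sequentially. (real n * c n) * (1 / real n) = c n"
    using eventually_gt_at_top[of 0] by eventually_elim simp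
  ultimately show ?thesis by (auto intro: Lim_transform_eventually)
qed

lemma has_index_quotient:
  assumes "has_index x \<rho>"
  shows "(\<lambda>n. x (Suc n) / x n) \<longlonglongrightarrow> 1"
  using tendsto_of_scaled[of "\<lambda>n. x (Suc n) / x n - 1" \<rho>] assms
  by (simp add: has_index_def LIM_zero_iff)

lemma has_index_quotient':
  assumes "has_index x \<rho>"
  shows "(\<lambda>n. x n / x (Suc n)) \<longlonglongrightarrow> 1"
  using tendsto_inverse[OF has_index_quotient[OF assms]] by simp

lemma has_indexI:
  assumes "\<And>n. n \<ge> 1 \<Longrightarrow> x n > 0" and "(\<lambda>n. real n * c n) \<longlonglongrightarrow> \<rho>"
    and "\<And>n. n \<ge> 1 \<Longrightarrow> x (Suc n) / x n = 1 + c n"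
  shows "has_index x \<rho>"
proof -
  have "\<forall>\<^sub>F n in sequentially. real n * c n = real n * (x (Suc n) / x n - 1)"
    using eventually_ge_at_top[of 1] by eventually_elim (simp add: assms(3))
  then show ?thesis
    using assms(1,2) by (auto simp: has_index_def intro: Lim_transform_eventually)
qed

lemma has_index_mult:
  assumes x: "has_index x \<rho>" and y: "has_index y \<sigma>"
  shows "has_index (\<lambda>n. x n * y n) (\<rho> + \<sigma>)"
proof (rule has_indexI)
  show "x n * y n > 0" if "n \<ge> 1" for n
    using that has_index_pos[OF x] has_index_pos[OF y] by simp
  have "(\<lambda>n. (real n * (x (Suc n) / x n - 1)) * (y (Suc n) / y n) + real n * (y (Suc n) / y n - 1)) \<longlonglongrightarrow> \<rho> * 1 + \<sigma>"
    using x y by (intro tendsto_intros has_index_quotient[OF y]) (auto simp: has_index_def)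
  then show "(\<lambda>n. real n * ((x (Suc n) / x n) * (y (Suc n) / y n) - 1)) \<longlonglongrightarrow> \<rho> + \<sigma>"
    by (simp add: algebra_simps)
qed simp

lemma has_index_inverse:
  assumes x: "has_index x \<rho>"
  shows "has_index (\<lambda>n. inverse (x n)) (- \<rho>)"
proof (rule has_indexI)
  show "inverse (x n) > 0" if "n \<ge> 1" for n
    using that has_index_pos[OF x] by simp
  have "(\<lambda>n. - (real n * (x (Suc n) / x n - 1)) * (x n / x (Suc n))) \<longlonglongrightarrow> - \<rho> * 1"
    using x by (intro tendsto_intros has_index_quotient'[OF x]) (auto simp: has_index_def)
  then show "(\<lambda>n. real n * (- (x (Suc n) / x n - 1) * (x n / x (Suc n)))) \<longlonglongrightarrow> - \<rho>"
    by (simp only: mult_minus_left mult_minus_right mult.assoc mult_1_right)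
  show "inverse (x (Suc n)) / inverse (x n) = 1 + - (x (Suc n) / x n - 1) * (x n / x (Suc n))" if "n \<ge> 1" for n
    using that has_index_pos[OF x, of n] has_index_pos[OF x, of "Suc n"] by (simp add: field_simps)
qed

lemma has_index_divide:
  assumes "has_index x \<rho>" "has_index y \<sigma>"
  shows "has_index (\<lambda>n. x n / y n) (\<rho> - \<sigma>)"
  using has_index_mult[OF assms(1) has_index_inverse[OF assms(2)]] by (simp add: divide_inverse)

lemma has_index_power2:
  assumes "has_index x \<rho>"
  shows "has_index (\<lambda>n. (x n)\<^sup>2) (2 * \<rho>)"
  using has_index_mult[OF assms assms] by (simp add: power2_eq_square)

lemma has_index_real: "has_index real 1"
  by (rule has_indexI[where c = "\<lambda>n. 1 / real n"])
    (auto simp: field_simps intro!: tendsto_eventually eventually_mono[OF eventually_gt_at_top[of 0]])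

text \<open>Multiplication by \<open>x (Suc n)\<close> turns the factor \<open>1 + c n\<close> into
  \<open>x (Suc n) / x n * (1 + c n)\<close>, and to first order the two relative increments add up
  to \<open>(\<rho> + c0) / n\<close>. A normaliser \<open>x\<close> is therefore useful when
  \<open>\<rho> + c0\<close> is negative.\<close>

lemma scaled_recursion:
  fixes z c e :: "nat \<Rightarrow> real"
  assumes x: "has_index x \<rho>" and c: "(\<lambda>n. real n * c n) \<longlonglongrightarrow> c0"
  obtains d where "d \<longlonglongrightarrow> - (\<rho> + c0)"
    and "\<And>n. n \<ge> 1 \<Longrightarrow> z (Suc n) = (1 + c n) * z n + e n \<Longrightarrow>
       x (Suc n) * z (Suc n) = (1 - d n / real n) * (x n * z n) + (real n * x (Suc n) * e n) / real n"
proof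
  define d where "d n = - (real n * (x (Suc n) / x n - 1) * (1 + c n) + real n * c n)" for n
  have "(\<lambda>n. - (real n * (x (Suc n) / x n - 1) * (1 + c n) + real n * c n)) \<longlonglongrightarrow> - (\<rho> * (1 + 0) + c0)"
    using x by (intro tendsto_intros tendsto_of_scaled[OF c] c) (auto simp: has_index_def)
  then show "d \<longlonglongrightarrow> - (\<rho> + c0)" by (simp add: d_def[abs_def])
  fix n :: nat assume n: "n \<ge> 1" and rec: "z (Suc n) = (1 + c n) * z n + e n"
  have "1 - d n / real n = x (Suc n) / x n * (1 + c n)"
    using n has_index_pos[OF x n] by (simp add: d_def field_simps)
  then have "(1 - d n / real n) * (x n * z n) = x (Suc n) * ((1 + c n) * z n)"
    using has_index_pos[OF x n] by simp
  moreover have "(real n * x (Suc n) * e n) / real n = x (Suc n) * e n"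
    using n by simp
  ultimately show "x (Suc n) * z (Suc n) = (1 - d n / real n) * (x n * z n) + (real n * x (Suc n) * e n) / real n"
    by (simp only: rec distrib_left)
qed

lemma scaled_recursion_tendsto:
  fixes z c e :: "nat \<Rightarrow> real"
  assumes x: "has_index x \<rho>" and c: "(\<lambda>n. real n * c n) \<longlonglongrightarrow> c0"
    and e: "(\<lambda>n. real n * x (Suc n) * e n) \<longlonglongrightarrow> f0" and neg: "\<rho> + c0 < 0"
    and rec: "\<And>n. n \<ge> 1 \<Longrightarrow> z (Suc n) = (1 + c n) * z n + e n"
  shows "(\<lambda>n. x n * z n) \<longlonglongrightarrow> f0 / - (\<rho> + c0)"
proof -
  obtain d where d: "d \<longlonglongrightarrow> - (\<rho> + c0)"
    and r: "\<And>n. n \<ge> 1 \<Longrightarrow> z (Suc n) = (1 + c n) * z n + e n \<Longrightarrow>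
       x (Suc n) * z (Suc n) = (1 - d n / real n) * (x n * z n) + (real n * x (Suc n) * e n) / real n"
    using scaled_recursion[OF x c] by blast
  show ?thesis
  proof (rule recursion_tendsto[OF _ d e])
    show "\<forall>\<^sub>F n in sequentially. x (Suc n) * z (Suc n) = (1 - d n / real n) * (x n * z n) + (real n * x (Suc n) * e n) / real n"
      using eventually_ge_at_top[of 1] by eventually_elim (intro r rec)
  qed (use neg in simp)
qed

lemma scaled_recursion_bounded:
  fixes z c e :: "nat \<Rightarrow> real"
  assumes x: "has_index x \<rho>" and c: "(\<lambda>n. real n * c n) \<longlonglongrightarrow> c0"
    and e: "(\<lambda>n. real n * x (Suc n) * e n) \<in> O(\<lambda>_. 1)" and neg: "\<rho> + c0 < 0"
    and rec: "\<And>n. n \<ge> 1 \<Longrightarrow> z (Suc n) = (1 + c n) * z n + e n"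
    and z: "\<And>n. n \<ge> 1 \<Longrightarrow> z n \<ge> 0"
  shows "\<exists>b. \<forall>n\<ge>1. x n * z n \<le> b"
proof -
  obtain d where d: "d \<longlonglongrightarrow> - (\<rho> + c0)"
    and r: "\<And>n. n \<ge> 1 \<Longrightarrow> z (Suc n) = (1 + c n) * z n + e n \<Longrightarrow>
       x (Suc n) * z (Suc n) = (1 - d n / real n) * (x n * z n) + (real n * x (Suc n) * e n) / real n"
    using scaled_recursion[OF x c] by blast
  obtain F where F: "\<forall>\<^sub>F n in sequentially. norm (real n * x (Suc n) * e n) \<le> F"
    using e by (auto elim!: landau_o.bigE)
  show ?thesis
  proof (rule recursion_bounded[OF _ d])
    show "\<forall>\<^sub>F n in sequentially. x (Suc n) * z (Suc n) \<le> (1 - d n / real n) * (x n * z n) + F / real n"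
      using F eventually_ge_at_top[of 1]
    proof eventually_elim
      case (elim n)
      then have "real n * x (Suc n) * e n / real n \<le> F / real n"
        by (intro divide_right_mono) auto
      then show ?case using r[OF elim(2) rec[OF elim(2)]] by linarith
    qed
    show "x n * z n \<ge> 0" if "n \<ge> 1" for n
      using z[OF that] has_index_pos[OF x that] by simp
  qed (use neg in auto)
qed

text \<open>This is the borderline rate 0, where the level \<open>f / d\<close> becomes infinite.
  For a target \<open>b\<close>, the rate is eventually below a positive \<open>\<epsilon>\<close>
  chosen so small that \<open>f / \<epsilon>\<close> exceeds \<open>b\<close>.\<close>

lemma recursion_at_top:
  fixes y d :: "nat \<Rightarrow> real"
  assumes d: "d \<longlonglongrightarrow> 0" and f: "f > 0" and y: "\<And>n. n \<ge> 1 \<Longrightarrow> y n \<ge> 0"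
    and rec: "\<forall>\<^sub>F n in sequentially. y (Suc n) \<ge> (1 - d n / real n) * y n + f / real n"
  shows "filterlim y at_top sequentially"
  unfolding filterlim_at_top_dense
proof
  fix b :: real
  define \<epsilon> where "\<epsilon> = f / (\<bar>b\<bar> + 1)"
  have \<epsilon>: "\<epsilon> > 0" using f by (simp add: \<epsilon>_def)
  show "\<forall>\<^sub>F n in sequentially. b < y n"
  proof (rule recursion_eventually_greater[OF \<epsilon>])
    have "\<forall>\<^sub>F n in sequentially. d n < \<epsilon>" by (rule order_tendstoD(2)[OF d \<epsilon>])
    then show "\<forall>\<^sub>F n in sequentially. y (Suc n) \<ge> (1 - \<epsilon> / real n) * y n + f / real n"
      using rec eventually_ge_at_top[of 1]
    proof eventually_elim
      case (elim n)
      have "(1 - \<epsilon> / real n) * y n \<le> (1 - d n / real n) * y n"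
        using elim y[of n] by (intro mult_right_mono diff_left_mono divide_right_mono) auto
      with elim show ?case by linarith
    qed
    show "b < f / \<epsilon>" using f by (simp add: \<epsilon>_def)
  qed
qed

text \<open>The constant must not vanish: only an eventually zero sequence is asymptotically
  equivalent to the zero sequence.\<close>

lemma asymp_equiv_const_multI:
  fixes f h :: "nat \<Rightarrow> real"
  assumes "(\<lambda>n. f n / h n) \<longlonglongrightarrow> c" "c \<noteq> 0"
  shows "f \<sim>[at_top] (\<lambda>n. c * h n)"
proof (rule asymp_equivI')
  have "(\<lambda>n. f n / h n / c) \<longlonglongrightarrow> c / c"
    using assms by (intro tendsto_divide tendsto_const)
  then show "(\<lambda>n. f n / (c * h n)) \<longlonglongrightarrow> 1"
    using assms(2) by (simp add: mult.commute)
qed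

section \<open>Karamata's theorem for regularly varying sequences\<close>

text \<open>An average over \<open>k < n\<close> is the integral of a step function that is constant
  between \<open>k / n\<close> and \<open>(k + 1) / n\<close>. At fixed \<open>x\<close> the
  integrand involves the index floor(x n), which is what regular variation speaks about, so
  convergence theorems for integrals apply to the sums.\<close>

lemma has_bochner_integral_floor_step:
  fixes g :: "nat \<Rightarrow> real"
  assumes "n > 0"
  shows "has_bochner_integral lborel (\<lambda>x. indicator {0..<1} x * g (nat \<lfloor>x * real n\<rfloor>))
    ((\<Sum>k<n. g k) / real n)"
proof -
  have eq: "indicator {0..<1} x * g (nat \<lfloor>x * real n\<rfloor>) =
      (\<Sum>k<n. indicator {real k / real n..<real (Suc k) / real n} x * g k)" for x :: real
  proof -
    have iff: "x \<in> {real k / real n..<real (Suc k) / real n} \<longleftrightarrow> 0 \<le> x \<and> nat \<lfloor>x * real n\<rfloor> = k" for k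
    proof -
      have "x \<in> {real k / real n..<real (Suc k) / real n} \<longleftrightarrow> real k \<le> x * real n \<and> x * real n < real k + 1"
        using assms by (auto simp: field_simps)
      also have "\<dots> \<longleftrightarrow> \<lfloor>x * real n\<rfloor> = int k"
        by (simp add: floor_eq_iff)
      also have "\<dots> \<longleftrightarrow> 0 \<le> x * real n \<and> nat \<lfloor>x * real n\<rfloor> = k"
        using zero_le_floor[of "x * real n"] by (auto simp: nat_eq_iff simp del: zero_le_floor)
      finally show ?thesis
        using assms by (simp add: zero_le_mult_iff)
    qed
    have lt: "nat \<lfloor>x * real n\<rfloor> < n \<longleftrightarrow> x < 1" if "0 \<le> x"
    proof -
      have "nat \<lfloor>x * real n\<rfloor> < n \<longleftrightarrow> \<lfloor>x * real n\<rfloor> < int n"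
        using assms by (subst nat_less_iff) (use that in auto)
      also have "\<dots> \<longleftrightarrow> x < 1"
        using assms by (simp add: floor_less_iff)
      finally show ?thesis .
    qed
    have "(\<Sum>k<n. indicator {real k / real n..<real (Suc k) / real n} x * g k) =
        (\<Sum>k<n. if k = nat \<lfloor>x * real n\<rfloor> then of_bool (0 \<le> x) * g k else 0)"
      by (intro sum.cong refl) (simp only: indicator_def iff of_bool_def, auto)
    also have "\<dots> = indicator {0..<1} x * g (nat \<lfloor>x * real n\<rfloor>)"
      using lt by (auto simp: sum.delta indicator_def)
    finally show ?thesis ..
  qed
  have "has_bochner_integral lborel
      (\<lambda>x. \<Sum>k<n. indicator {real k / real n..<real (Suc k) / real n} x * g k)
      (\<Sum>k<n. measure lborel {real k / real n..<real (Suc k) / real n} * g k)"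
    by (intro has_bochner_integral_sum has_bochner_integral_mult_left
        has_bochner_integral_real_indicator) (auto simp: divide_right_mono)
  also have "(\<Sum>k<n. measure lborel {real k / real n..<real (Suc k) / real n} * g k)
      = (\<Sum>k<n. g k) / real n"
    by (simp add: sum_divide_distrib divide_right_mono diff_divide_distrib[symmetric])
  finally show ?thesis
    by (simp add: eq)
qed

lemma filterlim_nat_floor_mult:
  assumes "(t::real) > 0"
  shows "filterlim (\<lambda>n. nat \<lfloor>t * real n\<rfloor>) at_top at_top"
proof -
  have "filterlim (\<lambda>n. t * real n) at_top at_top"
    using assms by (intro filterlim_tendsto_pos_mult_at_top[OF tendsto_const])
      (auto intro: filterlim_real_sequentially)
  then show ?thesis
    by (intro filterlim_compose[OF filterlim_nat_sequentially]
        filterlim_compose[OF filterlim_floor_sequentially])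
qed

lemma tendsto_nat_floor_mult:
  assumes "(t::real) \<ge> 0"
  shows "(\<lambda>n. real (nat \<lfloor>t * real n\<rfloor>) / real n) \<longlonglongrightarrow> t"
proof (rule real_tendsto_sandwich[where f="\<lambda>n. t - 1 / real n" and h="\<lambda>n. t"])
  show "\<forall>\<^sub>F n in sequentially. t - 1 / real n \<le> real (nat \<lfloor>t * real n\<rfloor>) / real n"
    using eventually_gt_at_top[of 0]
  proof eventually_elim
    case (elim n)
    have "t * real n - 1 \<le> real (nat \<lfloor>t * real n\<rfloor>)" by linarith
    then have "(t * real n - 1) / real n \<le> real (nat \<lfloor>t * real n\<rfloor>) / real n"
      by (rule divide_right_mono) simp
    with elim show ?case by (simp add: diff_divide_distrib)
  qed
  show "\<forall>\<^sub>F n in sequentially. real (nat \<lfloor>t * real n\<rfloor>) / real n \<le> t"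
    using eventually_gt_at_top[of 0]
  proof eventually_elim
    case (elim n)
    have "real (nat \<lfloor>t * real n\<rfloor>) \<le> t * real n"
      using assms by (simp add: of_nat_floor)
    with elim show ?case by (simp add: field_simps)
  qed
  show "(\<lambda>n. t - 1 / real n) \<longlonglongrightarrow> t"
    using tendsto_diff[OF tendsto_const lim_1_over_n, of t] by simp
qed simp

section \<open>Partial sums of a regularly varying sequence\<close>

locale rv_weights =
  fixes \<gamma> :: real and \<mu> :: "nat \<Rightarrow> real"
  assumes gamma_gt: "\<gamma> > -1"
    and mu_pos: "\<And>n. n \<ge> 1 \<Longrightarrow> \<mu> n > 0"
    and mu_rv: "regularly_varying \<gamma> \<mu>"
begin

abbreviation \<nu> where "\<nu> \<equiv> nu \<mu>"

lemma nu_Suc: "\<nu> (Suc n) = \<nu> n + \<mu> (Suc n)"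
  by (simp add: nu_def)

lemma nu_pos: "n \<ge> 1 \<Longrightarrow> \<nu> n > 0"
  unfolding nu_def by (intro sum_pos) (auto intro: mu_pos)

lemma nu_nonneg: "\<nu> n \<ge> 0"
  unfolding nu_def by (intro sum_nonneg) (auto intro: less_imp_le[OF mu_pos])

lemma nu_mono: "m \<le> n \<Longrightarrow> \<nu> m \<le> \<nu> n"
  unfolding nu_def by (intro sum_mono2) (auto intro: less_imp_le[OF mu_pos])

text \<open>The range \<open>k < n\<close> comes from floor(x n) < n for x < 1. The top weight
  \<open>\<mu> n\<close> is therefore missing and has to be accounted for separately.\<close>

lemma sum_mu_between:
  assumes "m < n"
  shows "(\<Sum>k<n. if m < k then \<mu> k else 0) = \<nu> n - \<mu> n - \<nu> m"
proof -
  have "\<nu> n = \<nu> m + (\<Sum>k\<in>{m<..n}. \<mu> k)"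
  proof -
    have "{1..n} = {1..m} \<union> {m<..n}" using assms by auto
    moreover have "sum \<mu> ({1..m} \<union> {m<..n}) = sum \<mu> {1..m} + sum \<mu> {m<..n}"
      by (rule sum.union_disjoint) auto
    ultimately show ?thesis
      unfolding nu_def by simp
  qed
  moreover have "{m<..n} = insert n {k\<in>{..<n}. m < k}"
    using assms by auto
  ultimately show ?thesis
    by (simp add: sum.inter_filter[symmetric])
qed

text \<open>Karamata's quotient; its limit is all that the moment recursions need to know about the
  growth of the weights.\<close>

definition ratio :: "nat \<Rightarrow> real" where
  "ratio n = real n * \<mu> n / \<nu> n"

lemma ratio_pos: "n \<ge> 1 \<Longrightarrow> ratio n > 0"
  by (simp add: ratio_def mu_pos nu_pos)

text \<open>The cut at \<open>\<delta>\<close> removes the small indices, where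
  \<open>\<mu> k / \<mu> n\<close> has no evident majorant and \<open>x powr \<gamma>\<close> is
  unbounded for negative \<open>\<gamma>\<close>. Comparing integer parts instead of
  \<open>x\<close> with \<open>\<delta>\<close> makes the integral an exact difference of values of
  \<open>\<nu>\<close> and \<open>\<mu>\<close>.\<close>

definition profile :: "real \<Rightarrow> nat \<Rightarrow> real \<Rightarrow> real" where
  "profile \<delta> n x = indicator {0..<1} x *
     (if nat \<lfloor>\<delta> * real n\<rfloor> < nat \<lfloor>x * real n\<rfloor> then \<mu> (nat \<lfloor>x * real n\<rfloor>) else 0)"

definition limit_profile :: "real \<Rightarrow> real \<Rightarrow> real" where
  "limit_profile \<delta> x = x powr \<gamma> * indicator {\<delta>..1} x"

lemma profile_nonneg: "profile \<delta> n x \<ge> 0"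
proof -
  have "0 \<le> (if m < k then \<mu> k else 0)" for m k :: nat
    using mu_pos[of k] by auto
  from mult_nonneg_nonneg[OF indicator_pos_le this] show ?thesis
    unfolding profile_def .
qed

lemma limit_profile_nonneg: "limit_profile \<delta> x \<ge> 0"
  by (auto simp: limit_profile_def indicator_def)

lemma has_integral_profile:
  assumes "0 < \<delta>" "\<delta> < 1" "n > 0"
  shows "has_bochner_integral lborel (profile \<delta> n)
    ((\<nu> n - \<mu> n - \<nu> (nat \<lfloor>\<delta> * real n\<rfloor>)) / real n)"
proof -
  have "\<delta> * real n < real n" using assms by simp
  then have "nat \<lfloor>\<delta> * real n\<rfloor> < n"
    using assms by (subst nat_less_iff) (auto simp: floor_less_iff)
  from sum_mu_between[OF this] has_bochner_integral_floor_step[OF assms(3),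
      of "\<lambda>k. if nat \<lfloor>\<delta> * real n\<rfloor> < k then \<mu> k else 0"]
  show ?thesis by (simp add: profile_def[abs_def])
qed

lemma has_integral_limit_profile:
  assumes "0 < \<delta>" "\<delta> < 1"
  shows "has_bochner_integral lborel (limit_profile \<delta>) ((1 - \<delta> powr (\<gamma> + 1)) / (\<gamma> + 1))"
proof -
  have "has_bochner_integral lborel (\<lambda>x. x powr \<gamma> * indicator {\<delta>..1} x)
     (1 powr (\<gamma> + 1) / (\<gamma> + 1) - \<delta> powr (\<gamma> + 1) / (\<gamma> + 1))"
  proof (rule has_bochner_integral_FTC_Icc_nonneg)
    fix x :: real assume "x \<in> {\<delta>..1}"
    then show "((\<lambda>x. x powr (\<gamma> + 1) / (\<gamma> + 1)) has_real_derivative x powr \<gamma>) (at x)"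
      using assms gamma_gt by (auto intro!: derivative_eq_intros)
  qed (use assms in auto)
  then show ?thesis
    by (simp add: limit_profile_def[abs_def] diff_divide_distrib)
qed

text \<open>Regular variation applies with the factor \<open>x\<close>. At
  \<open>x = \<delta>\<close> and \<open>x = 1\<close> the profile is zero for all \<open>n\<close>
  while the limit, defined on a closed interval, is not; two points do not affect the
  integrals.\<close>

lemma profile_tendsto:
  assumes "0 < \<delta>" "\<delta> < 1" "x \<noteq> \<delta>" "x \<noteq> 1"
  shows "(\<lambda>n. profile \<delta> n x / \<mu> n) \<longlonglongrightarrow> limit_profile \<delta> x"
proof -
  consider "x < \<delta>" | "\<delta> < x" "x < 1" | "x > 1" using assms by linarith
  then show ?thesis
  proof cases
    case 1
    have le: "nat \<lfloor>x * real n\<rfloor> \<le> nat \<lfloor>\<delta> * real n\<rfloor>" for n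
      using 1 by (intro nat_mono floor_mono) (simp add: mult_right_mono)
    then have "profile \<delta> n x = 0" for n
      unfolding profile_def by (simp only: leD[OF le] if_False mult_zero_right)
    with 1 show ?thesis by (simp add: limit_profile_def)
  next
    case 2
    have "(\<lambda>n. (real (nat \<lfloor>x * real n\<rfloor>) / real n) - real (nat \<lfloor>\<delta> * real n\<rfloor>) / real n) \<longlonglongrightarrow> x - \<delta>"
      using 2 assms by (intro tendsto_diff tendsto_nat_floor_mult) auto
    then have "\<forall>\<^sub>F n in sequentially.
        (real (nat \<lfloor>x * real n\<rfloor>) / real n) - real (nat \<lfloor>\<delta> * real n\<rfloor>) / real n > 0"
      by (rule order_tendstoD) (use 2 in simp)
    then have "\<forall>\<^sub>F n in sequentially. \<mu> (nat \<lfloor>x * real n\<rfloor>) / \<mu> n = profile \<delta> n x / \<mu> n"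
      using eventually_gt_at_top[of 0]
    proof eventually_elim
      case (elim n)
      then have "nat \<lfloor>\<delta> * real n\<rfloor> < nat \<lfloor>x * real n\<rfloor>"
        by (simp add: divide_less_cancel)
      with 2 assms show ?case by (simp add: profile_def)
    qed
    moreover have "(\<lambda>n. \<mu> (nat \<lfloor>x * real n\<rfloor>) / \<mu> n) \<longlonglongrightarrow> x powr \<gamma>"
      using mu_rv 2 assms by (simp add: regularly_varying_def)
    ultimately show ?thesis
      using 2 by (auto simp: limit_profile_def intro: Lim_transform_eventually)
  qed (simp add: profile_def limit_profile_def)
qed

lemma profile_tendsto_AE:
  assumes "0 < \<delta>" "\<delta> < 1"
  shows "AE x in lborel. (\<lambda>n. profile \<delta> n x / \<mu> n) \<longlonglongrightarrow> limit_profile \<delta> x"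
  using AE_lborel_singleton[of \<delta>] AE_lborel_singleton[of 1]
  by eventually_elim (use profile_tendsto[OF assms] in auto)

lemma profile_measurable:
  assumes "0 < \<delta>" "\<delta> < 1"
  shows "profile \<delta> n \<in> borel_measurable lborel"
proof (cases "n = 0")
  case False
  then show ?thesis using has_integral_profile[OF assms, of n]
    by (auto simp: has_bochner_integral_iff)
qed (simp add: profile_def[abs_def])

text \<open>Fatou's lemma, obtained by dominated convergence for the minimum with the limit.\<close>
lemma ratio_eventually_less:
  assumes "c > \<gamma> + 1"
  shows "\<forall>\<^sub>F n in sequentially. ratio n < c"
proof -
  \<comment> \<open>As \<open>\<delta>\<close> decreases to 0, the truncated integral of
    \<open>x powr \<gamma>\<close> tends to \<open>1 / (\<gamma> + 1)\<close>, which exceeds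
    \<open>1 / c\<close>; some positive \<open>\<delta>\<close> already suffices.\<close>
  have "((\<lambda>\<delta>. (1 - \<delta> powr (\<gamma> + 1)) / (\<gamma> + 1)) \<longlongrightarrow> (1 - 0) / (\<gamma> + 1)) (at_right 0)"
    using gamma_gt
    by (intro tendsto_intros tendsto_zero_powrI[where b = "\<gamma> + 1"])
       (auto simp: eventually_at_filter)
  moreover have "1 / c < (1 - 0) / (\<gamma> + 1)"
    using assms gamma_gt by (simp add: field_simps)
  ultimately have "\<forall>\<^sub>F \<delta> in at_right 0. 1 / c < (1 - \<delta> powr (\<gamma> + 1)) / (\<gamma> + 1)"
    by (rule order_tendstoD)
  moreover have "\<forall>\<^sub>F \<delta> in at_right (0::real). \<delta> \<in> {0<..<1}"
    by (rule eventually_at_right_real) simp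
  ultimately have "\<forall>\<^sub>F \<delta> in at_right (0::real). 1 / c < (1 - \<delta> powr (\<gamma> + 1)) / (\<gamma> + 1) \<and> 0 < \<delta> \<and> \<delta> < 1"
    by eventually_elim auto
  then obtain \<delta> where \<delta>: "1 / c < (1 - \<delta> powr (\<gamma> + 1)) / (\<gamma> + 1)" "0 < \<delta>" "\<delta> < 1"
    using eventually_happens' trivial_limit_at_right_real by blast
  note L = has_integral_limit_profile[OF \<delta>(2,3)]
  have [measurable]: "profile \<delta> n \<in> borel_measurable lborel" for n
    by (rule profile_measurable[OF \<delta>(2,3)])
  have [measurable]: "limit_profile \<delta> \<in> borel_measurable lborel"
    using L by (auto simp: has_bochner_integral_iff)
  have "(\<lambda>n. \<integral>x. min (profile \<delta> n x / \<mu> n) (limit_profile \<delta> x) \<partial>lborel) \<longlonglongrightarrow> (\<integral>x. limit_profile \<delta> x \<partial>lborel)"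
  proof (rule integral_dominated_convergence[where w="limit_profile \<delta>"])
    show "AE x in lborel. (\<lambda>n. min (profile \<delta> n x / \<mu> n) (limit_profile \<delta> x)) \<longlonglongrightarrow> limit_profile \<delta> x"
      using profile_tendsto_AE[OF \<delta>(2,3)]
    proof eventually_elim
      case (elim x)
      from tendsto_min[OF elim tendsto_const, of "limit_profile \<delta> x"] show ?case by simp
    qed
    \<comment> \<open>The value \<open>\<mu> 0\<close> is arbitrary and possibly negative, but at
      \<open>n = 0\<close> the profile is zero, so the quotient stays nonnegative.\<close>
    have mu0: "\<mu> n < 0 \<Longrightarrow> profile \<delta> n x = 0" for n x
      using mu_pos[of n] by (cases "n = 0") (auto simp: profile_def)
    have "profile \<delta> n x / \<mu> n \<ge> 0" for n x
      using mu0[of n x] profile_nonneg[of \<delta> n x] by (cases "\<mu> n < 0") auto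
    then show "AE x in lborel. norm (min (profile \<delta> n x / \<mu> n) (limit_profile \<delta> x)) \<le> limit_profile \<delta> x" for n
      using limit_profile_nonneg[of \<delta>] by (intro AE_I2) (auto simp: min_def)
  qed (use L in \<open>auto simp: has_bochner_integral_iff\<close>)
  moreover have "1 / c < (\<integral>x. limit_profile \<delta> x \<partial>lborel)"
    using \<delta>(1) L by (simp add: has_bochner_integral_iff)
  ultimately have "\<forall>\<^sub>F n in sequentially. 1 / c < (\<integral>x. min (profile \<delta> n x / \<mu> n) (limit_profile \<delta> x) \<partial>lborel)"
    by (rule order_tendstoD)
  then show ?thesis
    using eventually_ge_at_top[of 1]
  proof eventually_elim
    case (elim n)
    have P: "integrable lborel (\<lambda>x. profile \<delta> n x / \<mu> n)"
      using has_integral_profile[OF \<delta>(2,3), of n] elim by (auto simp: has_bochner_integral_iff)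
    have M: "integrable lborel (\<lambda>x. min (profile \<delta> n x / \<mu> n) (limit_profile \<delta> x))"
      using P L by (auto simp: has_bochner_integral_iff)
    have "(\<integral>x. min (profile \<delta> n x / \<mu> n) (limit_profile \<delta> x) \<partial>lborel) \<le> (\<integral>x. profile \<delta> n x / \<mu> n \<partial>lborel)"
      by (intro integral_mono M P) auto
    also have "\<dots> = (\<nu> n - \<mu> n - \<nu> (nat \<lfloor>\<delta> * real n\<rfloor>)) / real n / \<mu> n"
      using has_integral_profile[OF \<delta>(2,3), of n] elim by (auto simp: has_bochner_integral_iff)
    also have "\<dots> \<le> \<nu> n / real n / \<mu> n"
      using elim mu_pos[of n] nu_nonneg[of "nat \<lfloor>\<delta> * real n\<rfloor>"] by (intro divide_right_mono) auto
    also have "\<dots> = 1 / ratio n"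
      by (simp add: ratio_def)
    finally have "1 / c < 1 / ratio n" using elim by simp
    then show ?case
      using assms gamma_gt ratio_pos[of n] elim by (simp add: field_simps)
  qed
qed

lemma ratio_bounded:
  obtains C where "C > 0" "\<And>n. n \<ge> 1 \<Longrightarrow> ratio n \<le> C"
proof -
  obtain N where N: "\<And>n. n \<ge> N \<Longrightarrow> ratio n < \<gamma> + 2"
    using ratio_eventually_less[of "\<gamma> + 2"] by (auto simp: eventually_sequentially)
  define C where "C = Max (insert (\<gamma> + 2) (ratio ` {..<N}))"
  have "ratio n \<le> C" for n
  proof (cases "n < N")
    case True then show ?thesis unfolding C_def by (intro Max_ge) auto
  next
    case False
    then have "ratio n \<le> \<gamma> + 2" using N[of n] by auto
    also have "\<dots> \<le> C" unfolding C_def by (intro Max_ge) auto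
    finally show ?thesis .
  qed
  moreover have "C \<ge> \<gamma> + 2" unfolding C_def by (intro Max_ge) auto
  then have "C > 0" using gamma_gt by simp
  ultimately show ?thesis using that by blast
qed

text \<open>The weights between \<open>\<delta> * n\<close> and \<open>n\<close> sum to about
  \<open>n * \<mu> n\<close> times the integral of \<open>x powr \<gamma>\<close> over
  \<open>{\<delta>..1}\<close>. Dividing by \<open>\<nu> n\<close> rather than by
  \<open>n * \<mu> n\<close> is what makes a majorant available.\<close>

lemma nu_fraction_asymp:
  assumes \<delta>: "0 < \<delta>" "\<delta> < 1"
  shows "(\<lambda>n. 1 - \<nu> (nat \<lfloor>\<delta> * real n\<rfloor>) / \<nu> n - ratio n * ((1 - \<delta> powr (\<gamma> + 1)) / (\<gamma> + 1))) \<longlonglongrightarrow> 0"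
proof -
  obtain C where C: "C > 0" "\<And>n. n \<ge> 1 \<Longrightarrow> ratio n \<le> C" using ratio_bounded by blast
  note L = has_integral_limit_profile[OF \<delta>]
  have [measurable]: "profile \<delta> n \<in> borel_measurable lborel" for n
    by (rule profile_measurable[OF \<delta>])
  have [measurable]: "limit_profile \<delta> \<in> borel_measurable lborel"
    using L by (auto simp: has_bochner_integral_iff)
  define h where "h n x = (profile \<delta> n x / \<mu> n - limit_profile \<delta> x) * ratio n" for n x
  have B: "(\<lambda>n. ratio n / real n) \<longlonglongrightarrow> 0"
  proof (rule real_tendsto_sandwich[OF _ _ tendsto_const])
    show "\<forall>\<^sub>F n in sequentially. ratio n / real n \<le> C / real n"
      using eventually_ge_at_top[of 1] by eventually_elim (use C(2) in \<open>auto simp: divide_right_mono\<close>)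
    show "\<forall>\<^sub>F n in sequentially. 0 \<le> ratio n / real n"
      using eventually_ge_at_top[of 1] by eventually_elim (use ratio_pos in \<open>auto simp: less_imp_le\<close>)
    show "(\<lambda>n. C / real n) \<longlonglongrightarrow> 0" by (rule lim_const_over_n)
  qed
  \<comment> \<open>For k = floor(x n) the left side is
    \<open>ratio k * (\<nu> k / \<nu> n) * (n / k)\<close>, where \<open>ratio\<close> is bounded,
    \<open>\<nu>\<close> is monotone and \<open>k \<ge> \<delta> * n\<close>. This replaces uniform
    convergence of \<open>\<mu> k / \<mu> n\<close>.\<close>
  have prof_le: "profile \<delta> n x / \<mu> n * ratio n \<le> C / \<delta> * indicator {0..1} x" if n: "n \<ge> 1" for n x
  proof (cases "x \<in> {0..<1} \<and> nat \<lfloor>\<delta> * real n\<rfloor> < nat \<lfloor>x * real n\<rfloor>")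
    case True
    define k where "k = nat \<lfloor>x * real n\<rfloor>"
    have k: "k \<ge> 1" "\<delta> * real n \<le> real k" "k \<le> n"
    proof -
      show "k \<ge> 1" using True unfolding k_def by linarith
      have "\<delta> * real n \<le> real (nat \<lfloor>\<delta> * real n\<rfloor>) + 1" by linarith
      then show "\<delta> * real n \<le> real k" using True unfolding k_def by linarith
      have "real k \<le> x * real n" using True unfolding k_def by (intro of_nat_floor) auto
      also have "\<dots> \<le> 1 * real n" using True by (intro mult_right_mono) auto
      finally show "k \<le> n" by simp
    qed
    have "profile \<delta> n x / \<mu> n * ratio n = \<mu> k * real n / \<nu> n"
      using True mu_pos[OF n] by (simp add: profile_def k_def ratio_def)
    also have "\<dots> = ratio k * (\<nu> k / \<nu> n) * (real n / real k)"
      using k nu_pos[of k] by (simp add: ratio_def)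
    also have "\<dots> \<le> C * 1 * (1 / \<delta>)"
    proof (intro mult_mono)
      show "real n / real k \<le> 1 / \<delta>" using k \<delta> by (simp add: field_simps)
      show "\<nu> k / \<nu> n \<le> 1" using nu_mono[OF k(3)] nu_pos[OF n] by (simp add: field_simps)
    qed (use C k ratio_pos nu_nonneg nu_pos in \<open>auto simp: less_imp_le\<close>)
    finally show ?thesis using True by simp
  next
    case False
    then have "profile \<delta> n x = 0" by (auto simp: profile_def)
    then show ?thesis using C \<delta> by simp
  qed
  \<comment> \<open>The index is shifted because the majorant is established for
    \<open>n \<ge> 1\<close>.\<close>
  have "(\<lambda>n. \<integral>x. h (n + 1) x \<partial>lborel) \<longlonglongrightarrow> (\<integral>x. 0 \<partial>(lborel :: real measure))"
  proof (rule integral_dominated_convergence[where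
        w="\<lambda>x. C / \<delta> * indicator {0..1} x + C * limit_profile \<delta> x"])
    show "AE x in lborel. (\<lambda>n. h (n + 1) x) \<longlonglongrightarrow> 0"
      using profile_tendsto_AE[OF \<delta>]
    proof eventually_elim
      case (elim x)
      have "(\<lambda>n. h n x) \<longlonglongrightarrow> 0"
        unfolding h_def
      proof (rule lim_null_mult_right_bounded)
        show "(\<lambda>n. profile \<delta> n x / \<mu> n - limit_profile \<delta> x) \<longlonglongrightarrow> 0"
          using tendsto_diff[OF elim tendsto_const, of "limit_profile \<delta> x"] by simp
        show "\<forall>\<^sub>F n in sequentially. norm (ratio n) \<le> C"
          using eventually_ge_at_top[of 1]
          by eventually_elim (use C ratio_pos in \<open>auto simp: less_imp_le\<close>)
      qed
      from LIMSEQ_Suc[OF this] show ?case by simp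
    qed
    show "AE x in lborel. norm (h (n + 1) x) \<le> C / \<delta> * indicator {0..1} x + C * limit_profile \<delta> x" for n
    proof (rule AE_I2)
      fix x :: real
      have "norm (h (n + 1) x) \<le> profile \<delta> (n + 1) x / \<mu> (n + 1) * ratio (n + 1) + limit_profile \<delta> x * ratio (n + 1)"
        unfolding h_def left_diff_distrib
        by (rule order_trans[OF norm_triangle_ineq4])
          (use profile_nonneg[of \<delta> "n+1" x] limit_profile_nonneg[of \<delta> x] ratio_pos[of "n+1"] mu_pos[of "n+1"]
           in \<open>simp add: abs_mult\<close>)
      also have "\<dots> \<le> C / \<delta> * indicator {0..1} x + C * limit_profile \<delta> x"
        using prof_le[of "n + 1" x] mult_right_mono[OF C(2)[of "n + 1"] limit_profile_nonneg[of \<delta> x]]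
        by (intro add_mono) (auto simp: mult.commute)
      finally show "norm (h (n + 1) x) \<le> C / \<delta> * indicator {0..1} x + C * limit_profile \<delta> x" .
    qed
    show "integrable lborel (\<lambda>x. C / \<delta> * indicator {0..1} x + C * limit_profile \<delta> x)"
      using L by (intro Bochner_Integration.integrable_add integrable_mult_right)
        (auto simp: has_bochner_integral_iff)
  qed (auto simp: h_def)
  then have "(\<lambda>n. \<integral>x. h (Suc n) x \<partial>lborel) \<longlonglongrightarrow> 0"
    by simp
  then have "(\<lambda>n. \<integral>x. h n x \<partial>lborel) \<longlonglongrightarrow> 0"
    by (rule LIMSEQ_imp_Suc)
  \<comment> \<open>The correction \<open>ratio n / n = \<mu> n / \<nu> n\<close> is the top weight
    that the profile leaves out.\<close>
  moreover have "\<forall>\<^sub>F n in sequentially. (\<integral>x. h n x \<partial>lborel) + ratio n / real n =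
     1 - \<nu> (nat \<lfloor>\<delta> * real n\<rfloor>) / \<nu> n - ratio n * ((1 - \<delta> powr (\<gamma> + 1)) / (\<gamma> + 1))"
    using eventually_ge_at_top[of 1]
  proof eventually_elim
    case (elim n)
    have P: "has_bochner_integral lborel (\<lambda>x. profile \<delta> n x / \<mu> n)
       ((\<nu> n - \<mu> n - \<nu> (nat \<lfloor>\<delta> * real n\<rfloor>)) / real n / \<mu> n)"
      using has_integral_profile[OF \<delta>, of n] elim by (intro has_bochner_integral_divide_zero) auto
    have "(\<integral>x. h n x \<partial>lborel) = ((\<nu> n - \<mu> n - \<nu> (nat \<lfloor>\<delta> * real n\<rfloor>)) / real n / \<mu> n
       - (1 - \<delta> powr (\<gamma> + 1)) / (\<gamma> + 1)) * ratio n"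
      using has_bochner_integral_mult_left[OF has_bochner_integral_diff[OF P L], of "ratio n"]
      by (simp add: has_bochner_integral_iff h_def)
    moreover have "(\<nu> n - \<mu> n - \<nu> (nat \<lfloor>\<delta> * real n\<rfloor>)) / real n / \<mu> n * ratio n =
        1 - \<nu> (nat \<lfloor>\<delta> * real n\<rfloor>) / \<nu> n - ratio n / real n"
      using elim mu_pos[of n] nu_pos[of n] by (simp add: ratio_def field_simps)
    ultimately show ?case by (simp add: algebra_simps)
  qed
  ultimately show ?thesis
    using tendsto_add[OF _ B] by (force intro: Lim_transform_eventually)
qed


text \<open>Along m n = floor(delta n), the fraction \<open>\<nu> (m n) / \<nu> n\<close> can be
  computed both from the preceding asymptotics and from regular variation of \<open>\<mu>\<close>.
  Together they say that \<open>s (m n)\<close> is \<open>3 * s n - 2\<close> up to an error o(s n):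
  the map towards smaller indices has the repelling fixed point 1, which is the desired limit of
  \<open>s\<close>.\<close>

lemma ratio_tendsto: "ratio \<longlonglongrightarrow> \<gamma> + 1"
proof -
  define g where "g = \<gamma> + 1"
  have g: "g > 0" using gamma_gt by (simp add: g_def)
  \<comment> \<open>This gives \<open>\<delta> powr g = 1 / 3\<close>. The excess is then multiplied
    by 3 up to errors, which leaves room to absorb them and still double it.\<close>
  define \<delta> :: real where "\<delta> = 3 powr (- 1 / g)"
  have \<delta>: "0 < \<delta>" "\<delta> < 1"
    using g by (auto simp: \<delta>_def powr_less_one)
  have \<delta>_g: "\<delta> powr g = 1 / 3"
    using g by (simp add: \<delta>_def powr_powr)
  define m where "m n = nat \<lfloor>\<delta> * real n\<rfloor>" for n
  have m_top: "filterlim m at_top at_top"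
    unfolding m_def using \<delta>(1) by (rule filterlim_nat_floor_mult)
  have m_less: "m n < n" if "n \<ge> 1" for n
  proof -
    have "\<delta> * real n < real n" using that \<delta> by simp
    then show ?thesis
      unfolding m_def using that by (subst nat_less_iff) (use \<delta> in \<open>auto simp: floor_less_iff\<close>)
  qed
  define s where "s n = g / ratio n" for n
  have s_pos: "s n > 0" if "n \<ge> 1" for n
    using ratio_pos[OF that] g by (simp add: s_def)
  have frac: "(\<lambda>n. \<nu> (m n) / \<nu> n - (1 - (2/3) / s n)) \<longlonglongrightarrow> 0"
  proof -
    have "(\<lambda>n. - (1 - \<nu> (m n) / \<nu> n - ratio n * ((1 - \<delta> powr g) / g))) \<longlonglongrightarrow> - 0"
      using nu_fraction_asymp[OF \<delta>] unfolding m_def g_def by (rule tendsto_minus)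
    also have "(\<lambda>n. - (1 - \<nu> (m n) / \<nu> n - ratio n * ((1 - \<delta> powr g) / g))) =
        (\<lambda>n. \<nu> (m n) / \<nu> n - (1 - (2/3) / s n))"
      by (simp add: \<delta>_g s_def fun_eq_iff)
    finally show ?thesis by simp
  qed
  have "(\<lambda>n. inverse (real (m n) / real n * (\<mu> (m n) / \<mu> n))) \<longlonglongrightarrow> inverse (\<delta> * \<delta> powr \<gamma>)"
    using tendsto_nat_floor_mult[of \<delta>] mu_rv \<delta>
    by (intro tendsto_inverse tendsto_mult) (auto simp: m_def regularly_varying_def)
  also have "\<delta> * \<delta> powr \<gamma> = \<delta> powr g"
    using \<delta> by (simp add: g_def powr_add)
  finally have D: "(\<lambda>n. inverse (real (m n) / real n * (\<mu> (m n) / \<mu> n))) \<longlonglongrightarrow> 3"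
    by (simp add: \<delta>_g)
  \<comment> \<open>The difference between the product and \<open>3 - 2 / s n\<close> is split so
    that each vanishing factor meets a convergent or bounded one;
    \<open>1 / s n = ratio n / g\<close> is bounded.\<close>
  have "(\<lambda>n. inverse (real (m n) / real n * (\<mu> (m n) / \<mu> n)) * (\<nu> (m n) / \<nu> n - (1 - (2/3) / s n))
      + (inverse (real (m n) / real n * (\<mu> (m n) / \<mu> n)) - 3) * (1 - (2/3) / s n)) \<longlonglongrightarrow> 3 * 0 + 0"
  proof (intro tendsto_add tendsto_mult D frac)
    obtain C where C: "C > 0" "\<And>n. n \<ge> 1 \<Longrightarrow> ratio n \<le> C" using ratio_bounded by blast
    show "(\<lambda>n. (inverse (real (m n) / real n * (\<mu> (m n) / \<mu> n)) - 3) * (1 - (2/3) / s n)) \<longlonglongrightarrow> 0"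
    proof (rule lim_null_mult_right_bounded)
      show "(\<lambda>n. inverse (real (m n) / real n * (\<mu> (m n) / \<mu> n)) - 3) \<longlonglongrightarrow> 0"
        using D by (simp add: LIM_zero_iff)
      show "\<forall>\<^sub>F n in sequentially. norm (1 - (2/3) / s n) \<le> 1 + C / g"
        using eventually_ge_at_top[of 1]
      proof eventually_elim
        case (elim n)
        have "norm (1 - (2/3) / s n) \<le> 1 + (2/3) / s n"
          using s_pos[OF elim] by (simp add: abs_le_iff)
        also have "(2/3) / s n \<le> 1 / s n"
          using s_pos[OF elim] by (intro divide_right_mono) auto
        also have "1 / s n \<le> C / g"
          using C(2)[OF elim] g by (simp add: s_def divide_right_mono)
        finally show ?case by simp
      qed
    qed
  qed
  moreover have alg: "a * (F - (1 - (2/3) / t)) + (a - 3) * (1 - (2/3) / t) = a * F - (3 - 2 / t)" for a F t :: real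
    by (cases "t = 0") (auto simp: field_simps)
  ultimately have "(\<lambda>n. inverse (real (m n) / real n * (\<mu> (m n) / \<mu> n)) * (\<nu> (m n) / \<nu> n)
      - (3 - 2 / s n)) \<longlonglongrightarrow> 0"
    by (simp only: alg mult_zero_right add_0_right)
  moreover have "\<forall>\<^sub>F n in sequentially. inverse (real (m n) / real n * (\<mu> (m n) / \<mu> n)) * (\<nu> (m n) / \<nu> n)
      - (3 - 2 / s n) = s (m n) / s n - (3 - 2 / s n)"
    using eventually_ge_at_top[of 1] filterlim_at_top[THEN iffD1, OF m_top, rule_format, of 1]
  proof eventually_elim
    case (elim n)
    then show ?case
      using mu_pos[of n] mu_pos[of "m n"] nu_pos[of n] nu_pos[of "m n"] g
      by (simp add: s_def ratio_def field_simps)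
  qed
  ultimately have key: "(\<lambda>n. s (m n) / s n - (3 - 2 / s n)) \<longlonglongrightarrow> 0"
    by (rule Lim_transform_eventually)
  text \<open>An excess \<open>s n - 1 \<ge> \<eta>\<close> at least doubles when passing from \<open>n\<close> to \<open>m n < n\<close>; descending
    to bounded indices then shows that it cannot persist for large \<open>n\<close>.\<close>
  have doubling: "\<forall>\<^sub>F n in sequentially. s n \<ge> 1 + \<eta> \<longrightarrow> s (m n) - 1 \<ge> 2 * (s n - 1)" if "\<eta> > 0" for \<eta>
  proof -
    have "\<forall>\<^sub>F n in sequentially. - (\<eta> / (1 + \<eta>)) < s (m n) / s n - (3 - 2 / s n)"
      by (rule order_tendstoD[OF key]) (use that in simp)
    then show ?thesis using eventually_ge_at_top[of 1]
    proof eventually_elim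
      case (elim n)
      have sn: "s n > 0" using s_pos elim by simp
      show ?case
      proof
        assume s: "s n \<ge> 1 + \<eta>"
        have "- (\<eta> / (1 + \<eta>)) * s n < (s (m n) / s n - (3 - 2 / s n)) * s n"
          using elim sn by (intro mult_strict_right_mono) auto
        also have "\<dots> = s (m n) - 3 * s n + 2"
          using sn by (simp add: algebra_simps)
        finally have "s (m n) - 1 > 3 * (s n - 1) - \<eta> / (1 + \<eta>) * s n"
          by simp
        moreover have "\<eta> / (1 + \<eta>) * s n \<le> s n - 1"
          using s that by (simp add: field_simps)
        ultimately show "s (m n) - 1 \<ge> 2 * (s n - 1)" by simp
      qed
    qed
  qed
  have upper: "\<forall>\<^sub>F n in sequentially. s n \<le> 1 + \<eta>" if \<eta>: "\<eta> > 0" for \<eta>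
  proof -
    obtain N where N: "\<And>n. n \<ge> N \<Longrightarrow> s n \<ge> 1 + \<eta> \<Longrightarrow> s (m n) - 1 \<ge> 2 * (s n - 1)"
      using doubling[OF \<eta>] by (auto simp: eventually_sequentially)
    \<comment> \<open>\<open>K\<close> bounds the excess at every index: descending from
      \<open>n\<close> to \<open>m n\<close> never decreases an excess above \<open>\<eta>\<close>,
      until an index at most \<open>N\<close> or a small excess is reached.\<close>
    define K where "K = Max (insert \<eta> ((\<lambda>n. s n - 1) ` {..N}))"
    have K_ge: "K \<ge> \<eta>" unfolding K_def by (intro Max_ge) auto
    have bound: "s n - 1 \<le> K" for n
    proof (induction n rule: less_induct)
      case (less n)
      show ?case
      proof (cases "n \<le> N \<or> s n \<le> 1 + \<eta>")
        case True
        then show ?thesis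
        proof
          assume "n \<le> N"
          then show ?thesis unfolding K_def by (intro Max_ge) auto
        qed (use K_ge in linarith)
      next
        case False
        then have "s n - 1 \<le> 2 * (s n - 1)" using \<eta> by simp
        also have "\<dots> \<le> s (m n) - 1" using False by (intro N) auto
        also have "\<dots> \<le> K" using False by (intro less m_less) auto
        finally show ?thesis .
      qed
    qed
    \<comment> \<open>Read forwards, doubling says that an excess above \<open>\<eta>\<close> at
      \<open>n\<close> is at most half of that at \<open>m n\<close>. As \<open>m n\<close> tends to
      infinity with \<open>n\<close>, each eventual bound at \<open>m n\<close> yields half that
      bound at \<open>n\<close>.\<close>
    have halved: "\<forall>\<^sub>F n in sequentially. s n - 1 \<le> max \<eta> (K / 2 ^ j)" for j
    proof (induction j)
      case 0
      then show ?case using bound by (intro always_eventually) (auto simp: le_max_iff_disj)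
    next
      case (Suc j)
      have "\<forall>\<^sub>F n in sequentially. s (m n) - 1 \<le> max \<eta> (K / 2 ^ j)"
        using filterlim_iff[THEN iffD1, OF m_top] Suc by blast
      then show ?case
        using eventually_ge_at_top[of N]
      proof eventually_elim
        case (elim n)
        show ?case
        proof (cases "s n \<ge> 1 + \<eta>")
          case True
          then have "2 * (s n - 1) \<le> max \<eta> (K / 2 ^ j)" using N[OF elim(2) True] elim by linarith
          then show ?thesis using True \<eta> by (auto simp: le_max_iff_disj)
        qed (auto simp: le_max_iff_disj)
      qed
    qed
    obtain j where j: "K / 2 ^ j \<le> \<eta>"
    proof -
      have "(\<lambda>j. K / 2 ^ j) \<longlonglongrightarrow> 0"
        using LIMSEQ_inverse_realpow_zero[of 2, THEN tendsto_mult_left, of K] by (simp add: field_simps)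
      from order_tendstoD(2)[OF this \<eta>] show ?thesis
        using that by (meson eventually_happens' sequentially_bot less_imp_le)
    qed
    from halved[of j] show ?thesis
      by eventually_elim (use j in linarith)
  qed
  have lower: "\<forall>\<^sub>F n in sequentially. s n > c" if "c < 1" for c
  proof (cases "c > 0")
    case True
    then have "g / c > g" using that g by (simp add: field_simps)
    then have "g / c > \<gamma> + 1" by (simp add: g_def)
    from ratio_eventually_less[OF this] show ?thesis
      using eventually_ge_at_top[of 1]
      by eventually_elim (use ratio_pos True in \<open>auto simp: s_def field_simps\<close>)
  next
    case False
    show ?thesis using eventually_ge_at_top[of 1]
      by eventually_elim (use s_pos False in force)
  qed
  have "s \<longlonglongrightarrow> 1"
  proof (rule order_tendstoI)
    fix a :: real assume "1 < a"
    then have "(a - 1) / 2 > 0" by simp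
    from upper[OF this] show "\<forall>\<^sub>F n in sequentially. s n < a"
      by eventually_elim (use \<open>1 < a\<close> in \<open>simp add: field_simps\<close>)
  qed (rule lower)
  then have "(\<lambda>n. g / s n) \<longlonglongrightarrow> g / 1"
    by (intro tendsto_divide tendsto_const) auto
  then show ?thesis
    using g by (simp add: s_def g_def)
qed

end

section \<open>Second moments of the walk\<close>

text \<open>Inputs after time \<open>n\<close> have no influence. This makes each step a function of
  past variables alone, which are independent of those of the next time.\<close>

lemma step_cong:
  assumes "\<And>i. 1 \<le> i \<Longrightarrow> i \<le> n \<Longrightarrow> x i = x' i"
    and "\<And>i. 2 \<le> i \<Longrightarrow> i \<le> n \<Longrightarrow> a i = a' i"
    and "\<And>i. 2 \<le> i \<Longrightarrow> i \<le> n \<Longrightarrow> b i = b' i"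
  shows "step x a b n = step x' a' b' n"
  using assms
proof (induction n rule: less_induct)
  case (less n)
  show ?case
  proof (cases n)
    case (Suc m)
    show ?thesis
    proof (cases "m = 0")
      case True
      then show ?thesis using less.prems(1)[of 1] Suc by simp
    next
      case False
      then have "x n = x' n" "a n = a' n" "b n = b' n"
        using less.prems Suc by auto
      moreover have "step x a b k = step x' a' b' k" if "k \<le> m" for k
        using that Suc by (intro less.IH less.prems) auto
      ultimately show ?thesis using Suc False by simp
    qed
  qed simp
qed

text \<open>Splitting by the recalled time replaces a random index by a sum of products of a fresh
  factor and a fixed past step, to which independence applies. A recalled time 0 is consistent with
  the sum because \<open>step x a b 0 = 0\<close>.\<close>

lemma step_Suc_sum:
  assumes "n \<ge> 1"
  shows "step x a b (Suc n) =
    (\<Sum>k=1..n. of_bool (a (Suc n)) * of_bool (b (Suc n) = k) * step x a b k) +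
    (1 - of_bool (a (Suc n))) * x (Suc n)"
proof -
  have "(\<Sum>k=1..n. of_bool (b (Suc n) = k) * step x a b k) =
      (\<Sum>k=1..n. if k = b (Suc n) then step x a b (b (Suc n)) else 0)"
    by (intro sum.cong) auto
  also have "\<dots> = (if b (Suc n) \<le> n then step x a b (b (Suc n)) else 0)"
    by (cases "b (Suc n)") (auto simp: sum.delta)
  finally show ?thesis
    using assms by (simp add: sum_distrib_left mult.assoc)
qed

text \<open>The block \<open>J\<close> is bundled into one variable, labelled \<open>None\<close>,
  beside the single variables labelled \<open>Some i\<close>. Grouping disjoint index sets preserves
  independence, so the expectation of the product factorises.\<close>

lemma (in prob_space) indep_vars_block_product:
  fixes Z :: "'i \<Rightarrow> 'a \<Rightarrow> real" and G :: "('i \<Rightarrow> real) \<Rightarrow> real"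
  assumes ind: "indep_vars (\<lambda>_. borel) Z I" and J: "J \<subseteq> I" and T: "finite T" "T \<subseteq> I" "T \<inter> J = {}"
    and G: "G \<in> borel_measurable (PiM J (\<lambda>_. borel))" "integrable M (\<lambda>\<omega>. G (\<lambda>i\<in>J. Z i \<omega>))"
    and f: "\<And>i. i \<in> T \<Longrightarrow> f i \<in> borel_measurable borel"
      "\<And>i. i \<in> T \<Longrightarrow> integrable M (\<lambda>\<omega>. f i (Z i \<omega>))"
  shows "integrable M (\<lambda>\<omega>. G (\<lambda>i\<in>J. Z i \<omega>) * (\<Prod>i\<in>T. f i (Z i \<omega>)))"
    and "(\<integral>\<omega>. G (\<lambda>i\<in>J. Z i \<omega>) * (\<Prod>i\<in>T. f i (Z i \<omega>)) \<partial>M) =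
      (\<integral>\<omega>. G (\<lambda>i\<in>J. Z i \<omega>) \<partial>M) * (\<Prod>i\<in>T. \<integral>\<omega>. f i (Z i \<omega>) \<partial>M)"
proof -
  define K where "K = case_option J (\<lambda>i. {i})"
  define L where "L = insert None (Some ` T)"
  define V where "V j \<omega> = (case j of None \<Rightarrow> G (\<lambda>i\<in>J. Z i \<omega>) | Some i \<Rightarrow> f i (Z i \<omega>))" for j \<omega>
  have fr: "(\<lambda>r. f i (r i)) \<in> borel_measurable (PiM {i} (\<lambda>_. borel))" if "i \<in> T" for i
    by (rule measurable_compose[OF _ f(1)[OF that]]) (rule measurable_component_singleton, simp)
  have "indep_vars (\<lambda>j. PiM (K j) (\<lambda>_. borel)) (\<lambda>j \<omega>. restrict (\<lambda>i. Z i \<omega>) (K j)) L"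
    using J T by (intro indep_vars_restrict[OF ind]) (auto simp: K_def L_def disjoint_family_on_def)
  then have "indep_vars (\<lambda>_. borel)
     (\<lambda>j \<omega>. (case j of None \<Rightarrow> G | Some i \<Rightarrow> (\<lambda>r. f i (r i))) (restrict (\<lambda>i. Z i \<omega>) (K j))) L"
    by (rule indep_vars_compose2)
      (auto simp: L_def K_def G fr)
  also have "?this \<longleftrightarrow> indep_vars (\<lambda>_. borel) V L"
    by (intro indep_vars_cong) (auto simp: V_def K_def split: option.splits)
  finally have iV: "indep_vars (\<lambda>_. borel) V L" .
  have fin: "finite L" using T by (simp add: L_def)
  have int: "integrable M (V j)" if "j \<in> L" for j
    using that G f by (auto simp: L_def V_def[abs_def])
  have prod: "(\<Prod>j\<in>L. h j) = h None * (\<Prod>i\<in>T. h (Some i))" for h :: "_ \<Rightarrow> real"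
    unfolding L_def using T by (subst prod.insert) (auto simp: prod.reindex)
  show "integrable M (\<lambda>\<omega>. G (\<lambda>i\<in>J. Z i \<omega>) * (\<Prod>i\<in>T. f i (Z i \<omega>)))"
    using indep_vars_integrable[OF fin iV int] by (simp add: prod V_def)
  show "(\<integral>\<omega>. G (\<lambda>i\<in>J. Z i \<omega>) * (\<Prod>i\<in>T. f i (Z i \<omega>)) \<partial>M) =
      (\<integral>\<omega>. G (\<lambda>i\<in>J. Z i \<omega>) \<partial>M) * (\<Prod>i\<in>T. \<integral>\<omega>. f i (Z i \<omega>) \<partial>M)"
    using indep_vars_lebesgue_integral[OF fin iV int] by (simp add: prod V_def)
qed

section \<open>The steps as functions of finitely many independent variables\<close>

type_synonym source = "nat + nat + nat"

definition past_index :: "nat \<Rightarrow> source set" where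
  "past_index n = {1..n} <+> ({2..n} <+> {2..n})"

text \<open>The inverse of the encoding of \<open>\<alpha>\<close> and \<open>\<beta>\<close> as real variables in \<^const>\<open>srrw_rvm\<close>.\<close>
definition step_of :: "nat \<Rightarrow> (source \<Rightarrow> real) \<Rightarrow> real" where
  "step_of n z = step (\<lambda>i. z (Inl i)) (\<lambda>i. z (Inr (Inl i)) = 1) (\<lambda>i. nat \<lfloor>z (Inr (Inr i))\<rfloor>) n"

lemma step_of_measurable:
  "k \<le> n \<Longrightarrow> step_of k \<in> borel_measurable (PiM (past_index n) (\<lambda>_. borel))"
proof (induction k rule: less_induct)
  case (less k)
  show ?case
  proof (cases k)
    case 0
    then show ?thesis by (simp add: step_of_def[abs_def])
  next
    case (Suc m)
    have comp: "(\<lambda>z. z i) \<in> borel_measurable (PiM (past_index n) (\<lambda>_. borel :: real measure))"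
      if "i \<in> past_index n" for i
      using that by (rule measurable_component_singleton)
    have [measurable]: "(\<lambda>z. z (Inl k)) \<in> borel_measurable (PiM (past_index n) (\<lambda>_. borel :: real measure))"
      using less.prems Suc by (intro comp) (auto simp: past_index_def)
    show ?thesis
    proof (cases "m = 0")
      case True
      with Suc have "step_of k = (\<lambda>z. z (Inl k))" by (simp add: step_of_def fun_eq_iff)
      then show ?thesis by simp
    next
      case False
      have [measurable]:
        "(\<lambda>z. z (Inr (Inl k))) \<in> borel_measurable (PiM (past_index n) (\<lambda>_. borel :: real measure))"
        "(\<lambda>z. z (Inr (Inr k))) \<in> borel_measurable (PiM (past_index n) (\<lambda>_. borel :: real measure))"
        by (intro comp; use less.prems Suc False in \<open>auto simp: past_index_def\<close>)+
      have IH[measurable]: "step_of j \<in> borel_measurable (PiM (past_index n) (\<lambda>_. borel))" if "j \<in> {1..m}" for j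
        using that less.prems Suc by (intro less.IH) auto
      have "step_of k = (\<lambda>z. (\<Sum>j=1..m. (if z (Inr (Inl k)) = 1 then 1 else 0) *
           (if nat \<lfloor>z (Inr (Inr k))\<rfloor> = j then 1 else 0) * step_of j z) +
           (1 - (if z (Inr (Inl k)) = 1 then 1 else 0)) * z (Inl k))"
        unfolding Suc step_of_def
        by (subst step_Suc_sum) (use False in \<open>auto simp: of_bool_def\<close>)
      also have "\<dots> \<in> borel_measurable (PiM (past_index n) (\<lambda>_. borel))"
        by measurable
      finally show ?thesis .
    qed
  qed
qed

section \<open>One step of the walk in relation to its past\<close>

locale srrw_L2 = srrw_rvm +
  assumes xi_sq_integrable: "integrable M (\<lambda>\<omega>. (\<xi> 1 \<omega>)\<^sup>2)"
    and xi_sq_mean: "expectation (\<lambda>\<omega>. (\<xi> 1 \<omega>)\<^sup>2) = 1"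
begin

definition source_var :: "source \<Rightarrow> 'a \<Rightarrow> real" where
  "source_var = case_sum \<xi> (case_sum (\<lambda>n \<omega>. of_bool (\<alpha> n \<omega>)) (\<lambda>n \<omega>. real (\<beta> n \<omega>)))"

definition past :: "nat \<Rightarrow> 'a \<Rightarrow> source \<Rightarrow> real" where
  "past n \<omega> = (\<lambda>i\<in>past_index n. source_var i \<omega>)"

definition X :: "nat \<Rightarrow> 'a \<Rightarrow> real" where
  "X n \<omega> = step (\<lambda>i. \<xi> i \<omega>) (\<lambda>i. \<alpha> i \<omega>) (\<lambda>i. \<beta> i \<omega>) n"

lemma source_var_measurable:
  "i \<in> {1..} <+> ({2..} <+> {2..}) \<Longrightarrow> source_var i \<in> borel_measurable M"
  using indep by (auto simp: indep_vars_def source_var_def)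

lemma X_eq_step_of: "k \<le> n \<Longrightarrow> X k \<omega> = step_of k (past n \<omega>)"
  unfolding X_def step_of_def
  by (rule step_cong) (auto simp: past_def past_index_def source_var_def)

lemma past_measurable: "past n \<in> measurable M (PiM (past_index n) (\<lambda>_. borel))"
  unfolding past_def
  by (intro measurable_restrict source_var_measurable) (auto simp: past_index_def)

lemma X_measurable [measurable]: "X n \<in> borel_measurable M"
proof -
  have "(\<lambda>\<omega>. step_of n (past n \<omega>)) \<in> borel_measurable M"
    by (rule measurable_compose[OF past_measurable step_of_measurable]) simp
  then show ?thesis by (simp add: X_eq_step_of[symmetric])
qed

lemma alpha_measurable:
  assumes "n \<ge> 2"
  shows "(\<lambda>\<omega>. of_bool (\<alpha> n \<omega>) :: real) \<in> borel_measurable M"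
  using source_var_measurable[of "Inr (Inl n)"] assms by (auto simp: source_var_def)

lemma integrable_alpha:
  assumes "n \<ge> 2"
  shows "integrable M (\<lambda>\<omega>. of_bool (\<alpha> n \<omega>) :: real)"
  by (rule integrable_const_bound[where B = 1]) (use alpha_measurable[OF assms] in auto)

lemma expectation_alpha:
  assumes "n \<ge> 2"
  shows "expectation (\<lambda>\<omega>. of_bool (\<alpha> n \<omega>)) = p"
proof -
  have "{\<omega> \<in> space M. of_bool (\<alpha> n \<omega>) = (1::real)} \<in> events"
    using alpha_measurable[OF assms] by measurable
  then have "Measurable.pred M (\<alpha> n)"
    by (simp add: pred_def)
  then have "expectation (\<lambda>\<omega>. of_bool (\<alpha> n \<omega>)) =
      (\<integral>b. of_bool b \<partial>distr M (count_space UNIV) (\<alpha> n) :: real)"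
    by (subst integral_distr) auto
  also have "\<dots> = p"
    unfolding alpha_distr[OF assms] using p_range by simp
  finally show ?thesis .
qed

lemma expectation_beta:
  assumes "1 \<le> k" "k \<le> n"
  shows "integrable M (\<lambda>\<omega>. of_bool (\<beta> (Suc n) \<omega> = k) :: real)"
    and "expectation (\<lambda>\<omega>. of_bool (\<beta> (Suc n) \<omega> = k)) = \<mu> k / nu \<mu> n"
proof -
  have "(\<lambda>\<omega>. real (\<beta> (Suc n) \<omega>)) \<in> borel_measurable M"
    using source_var_measurable[OF InrI[OF InrI], of "Suc n"] assms by (simp add: source_var_def)
  then have "{\<omega> \<in> space M. real (\<beta> (Suc n) \<omega>) = real k} \<in> events"
    by measurable
  then have ev: "{\<omega> \<in> space M. \<beta> (Suc n) \<omega> = k} \<in> events" by simp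
  have eq: "of_bool (\<beta> (Suc n) \<omega> = k) = indicator {\<omega> \<in> space M. \<beta> (Suc n) \<omega> = k} \<omega>"
    if "\<omega> \<in> space M" for \<omega> using that by (simp add: indicator_def)
  show "integrable M (\<lambda>\<omega>. of_bool (\<beta> (Suc n) \<omega> = k) :: real)"
    using integrable_real_indicator[OF ev]
    by (simp add: eq emeasure_eq_measure cong: Bochner_Integration.integrable_cong)
  show "expectation (\<lambda>\<omega>. of_bool (\<beta> (Suc n) \<omega> = k)) = \<mu> k / nu \<mu> n"
    using ev beta_distr[of "Suc n" k] assms by (simp add: eq cong: Bochner_Integration.integral_cong)
qed

lemma xi_transfer:
  assumes "n \<ge> 1" and f [measurable]: "f \<in> borel_measurable borel"
    and "integrable M (\<lambda>\<omega>. f (\<xi> 1 \<omega>) :: real)"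
  shows "integrable M (\<lambda>\<omega>. f (\<xi> n \<omega>))"
    and "expectation (\<lambda>\<omega>. f (\<xi> n \<omega>)) = expectation (\<lambda>\<omega>. f (\<xi> 1 \<omega>))"
proof -
  have m [measurable]: "\<xi> k \<in> borel_measurable M" if "k \<ge> 1" for k
    using source_var_measurable[of "Inl k"] that by (auto simp: source_var_def)
  have "integrable (distr M borel (\<xi> n)) f"
    unfolding xi_ident[OF assms(1)] using assms m[of 1] by (simp add: integrable_distr_eq)
  then show "integrable M (\<lambda>\<omega>. f (\<xi> n \<omega>))"
    using m[OF assms(1)] by (simp add: integrable_distr_eq)
  show "expectation (\<lambda>\<omega>. f (\<xi> n \<omega>)) = expectation (\<lambda>\<omega>. f (\<xi> 1 \<omega>))"
    using integral_distr[OF m[OF assms(1)] f] integral_distr[OF m[of 1] f] xi_ident[OF assms(1)] by simp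
qed

text \<open>The indices of \<open>\<alpha>\<close> and \<open>\<beta>\<close> at time
  \<open>Suc n\<close> lie outside \<open>past_index n\<close>. The functional \<open>G\<close> is
  left general because it stands for the square of a past step in one application and for a past
  step times a weighted sum in another.\<close>

lemma recall_expectation:
  assumes k: "1 \<le> k" "k \<le> n"
    and G: "G \<in> borel_measurable (PiM (past_index n) (\<lambda>_. borel))" "integrable M (\<lambda>\<omega>. G (past n \<omega>))"
  shows "integrable M (\<lambda>\<omega>. of_bool (\<alpha> (Suc n) \<omega>) * of_bool (\<beta> (Suc n) \<omega> = k) * G (past n \<omega>))"
    and "expectation (\<lambda>\<omega>. of_bool (\<alpha> (Suc n) \<omega>) * of_bool (\<beta> (Suc n) \<omega> = k) * G (past n \<omega>)) =
      p * (\<mu> k / nu \<mu> n) * expectation (\<lambda>\<omega>. G (past n \<omega>))"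
proof -
  define T :: "source set" where "T = {Inr (Inl (Suc n)), Inr (Inr (Suc n))}"
  define f :: "source \<Rightarrow> real \<Rightarrow> real" where
    "f = case_sum (\<lambda>_ x. x) (case_sum (\<lambda>_ x. x) (\<lambda>_. indicator {real k}))"
  have ind: "of_bool (j = k) = (indicator {real k} (real j) :: real)" for j
    by (simp add: indicator_def)
  have int: "integrable M (\<lambda>\<omega>. f i (source_var i \<omega>))" if "i \<in> T" for i
    using that integrable_alpha[of "Suc n"] expectation_beta(1)[OF k] k
    by (auto simp: T_def f_def source_var_def ind)
  have sub: "past_index n \<subseteq> {1..} <+> ({2..} <+> {2..})" "finite T" "T \<subseteq> {1..} <+> ({2..} <+> {2..})"
    "T \<inter> past_index n = {}"
    using k by (auto simp: past_index_def T_def)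
  have meas: "f i \<in> borel_measurable borel" for i
    by (auto simp: f_def split: sum.splits)
  note B = indep_vars_block_product[OF indep[folded source_var_def] sub G(1) G(2)[unfolded past_def] meas int]
  have prod: "G z * (\<Prod>i\<in>T. f i (source_var i \<omega>)) =
      of_bool (\<alpha> (Suc n) \<omega>) * of_bool (\<beta> (Suc n) \<omega> = k) * G z" for z \<omega>
    by (simp add: T_def f_def source_var_def ind)
  show "integrable M (\<lambda>\<omega>. of_bool (\<alpha> (Suc n) \<omega>) * of_bool (\<beta> (Suc n) \<omega> = k) * G (past n \<omega>))"
    using B(1) unfolding prod past_def .
  have "(\<Prod>i\<in>T. \<integral>\<omega>. f i (source_var i \<omega>) \<partial>M) = p * (\<mu> k / nu \<mu> n)"
    using expectation_alpha[of "Suc n"] expectation_beta(2)[OF k] k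
    by (simp add: T_def f_def source_var_def ind)
  then show "expectation (\<lambda>\<omega>. of_bool (\<alpha> (Suc n) \<omega>) * of_bool (\<beta> (Suc n) \<omega> = k) * G (past n \<omega>)) =
      p * (\<mu> k / nu \<mu> n) * expectation (\<lambda>\<omega>. G (past n \<omega>))"
    using B(2) unfolding prod past_def by (simp only: mult_ac)
qed

text \<open>Used with the square as \<open>h\<close>, where the second moment 1 enters, and with the
  identity, where the mean 0 removes the innovation.\<close>

lemma innovation_expectation:
  assumes n: "n \<ge> 1" and h: "h \<in> borel_measurable borel" "integrable M (\<lambda>\<omega>. h (\<xi> 1 \<omega>))"
    and G: "G \<in> borel_measurable (PiM (past_index n) (\<lambda>_. borel))" "integrable M (\<lambda>\<omega>. G (past n \<omega>))"
  shows "integrable M (\<lambda>\<omega>. (1 - of_bool (\<alpha> (Suc n) \<omega>)) * h (\<xi> (Suc n) \<omega>) * G (past n \<omega>))"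
    and "expectation (\<lambda>\<omega>. (1 - of_bool (\<alpha> (Suc n) \<omega>)) * h (\<xi> (Suc n) \<omega>) * G (past n \<omega>)) =
      (1 - p) * expectation (\<lambda>\<omega>. h (\<xi> 1 \<omega>)) * expectation (\<lambda>\<omega>. G (past n \<omega>))"
proof -
  define T :: "source set" where "T = {Inr (Inl (Suc n)), Inl (Suc n)}"
  define f :: "source \<Rightarrow> real \<Rightarrow> real" where
    "f = case_sum (\<lambda>_. h) (\<lambda>_ x. 1 - x)"
  have int: "integrable M (\<lambda>\<omega>. f i (source_var i \<omega>))" if "i \<in> T" for i
    using that integrable_alpha[of "Suc n"] xi_transfer(1)[OF _ h, of "Suc n"] n
    by (auto simp: T_def f_def source_var_def)
  have sub: "past_index n \<subseteq> {1..} <+> ({2..} <+> {2..})" "finite T" "T \<subseteq> {1..} <+> ({2..} <+> {2..})"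
    "T \<inter> past_index n = {}"
    using n by (auto simp: past_index_def T_def)
  have meas: "f i \<in> borel_measurable borel" for i
    using h by (auto simp: f_def split: sum.splits)
  note B = indep_vars_block_product[OF indep[folded source_var_def] sub G(1) G(2)[unfolded past_def] meas int]
  have prod: "G z * (\<Prod>i\<in>T. f i (source_var i \<omega>)) =
      (1 - of_bool (\<alpha> (Suc n) \<omega>)) * h (\<xi> (Suc n) \<omega>) * G z" for z \<omega>
    by (simp add: T_def f_def source_var_def)
  show "integrable M (\<lambda>\<omega>. (1 - of_bool (\<alpha> (Suc n) \<omega>)) * h (\<xi> (Suc n) \<omega>) * G (past n \<omega>))"
    using B(1) unfolding prod past_def .
  have "(\<Prod>i\<in>T. \<integral>\<omega>. f i (source_var i \<omega>) \<partial>M) = (1 - p) * expectation (\<lambda>\<omega>. h (\<xi> 1 \<omega>))"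
    using expectation_alpha[of "Suc n"] xi_transfer(2)[OF _ h, of "Suc n"] n integrable_alpha[of "Suc n"]
    by (simp add: T_def f_def source_var_def prob_space)
  then show "expectation (\<lambda>\<omega>. (1 - of_bool (\<alpha> (Suc n) \<omega>)) * h (\<xi> (Suc n) \<omega>) * G (past n \<omega>)) =
      (1 - p) * expectation (\<lambda>\<omega>. h (\<xi> 1 \<omega>)) * expectation (\<lambda>\<omega>. G (past n \<omega>))"
    using B(2) unfolding prod past_def by (simp only: mult_ac)
qed

lemma X_Suc:
  assumes "n \<ge> 1"
  shows "X (Suc n) \<omega> = (\<Sum>k=1..n. of_bool (\<alpha> (Suc n) \<omega>) * of_bool (\<beta> (Suc n) \<omega> = k) * X k \<omega>) +
     (1 - of_bool (\<alpha> (Suc n) \<omega>)) * \<xi> (Suc n) \<omega>"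
  unfolding X_def by (rule step_Suc_sum[OF assms])

text \<open>The events of recalling a given time exclude one another and exclude a fresh innovation,
  so all cross terms vanish.\<close>

lemma X_Suc_sq:
  assumes "n \<ge> 1"
  shows "(X (Suc n) \<omega>)\<^sup>2 =
     (\<Sum>k=1..n. of_bool (\<alpha> (Suc n) \<omega>) * of_bool (\<beta> (Suc n) \<omega> = k) * (X k \<omega>)\<^sup>2) +
     (1 - of_bool (\<alpha> (Suc n) \<omega>)) * (\<xi> (Suc n) \<omega>)\<^sup>2"
proof -
  have *: "(\<Sum>k=1..n. of_bool (b = k) * h k) = (if 1 \<le> b \<and> b \<le> n then h b else 0)"
    for b and h :: "nat \<Rightarrow> real"
    by (simp add: of_bool_def if_distrib[of "\<lambda>x. x * _"] cong: if_cong)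
  show ?thesis
    unfolding X_Suc[OF assms]
    by (cases "\<alpha> (Suc n) \<omega>") (use * in auto)
qed

lemma nu_pos: "n \<ge> 1 \<Longrightarrow> nu \<mu> n > 0"
  unfolding nu_def by (intro sum_pos) (auto intro: mu_pos)

text \<open>The second moment of a new step is \<open>p\<close> times a weighted average of earlier
  ones plus \<open>1 - p\<close> times that of an innovation, so the value 1 is preserved.\<close>

lemma X_second_moment:
  assumes "n \<ge> 1"
  shows "integrable M (\<lambda>\<omega>. (X n \<omega>)\<^sup>2)" and "expectation (\<lambda>\<omega>. (X n \<omega>)\<^sup>2) = 1"
proof -
  from assms have "integrable M (\<lambda>\<omega>. (X n \<omega>)\<^sup>2) \<and> expectation (\<lambda>\<omega>. (X n \<omega>)\<^sup>2) = 1"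
  proof (induction n rule: less_induct)
    case (less n)
    show ?case
    proof (cases "n = 1")
      case True
      then show ?thesis using xi_sq_integrable xi_sq_mean by (simp add: X_def)
    next
      case False
      then obtain m where m: "n = Suc m" "m \<ge> 1"
        using less.prems by (cases n) auto
      define G where "G k z = (step_of k z)\<^sup>2" for k z
      have GX: "G k (past m \<omega>) = (X k \<omega>)\<^sup>2" if "k \<le> m" for k \<omega>
        using X_eq_step_of[OF that] by (simp add: G_def)
      have R: "integrable M (\<lambda>\<omega>. of_bool (\<alpha> (Suc m) \<omega>) * of_bool (\<beta> (Suc m) \<omega> = k) * (X k \<omega>)\<^sup>2)"
        "expectation (\<lambda>\<omega>. of_bool (\<alpha> (Suc m) \<omega>) * of_bool (\<beta> (Suc m) \<omega> = k) * (X k \<omega>)\<^sup>2) = p * (\<mu> k / nu \<mu> m)"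
        if k: "1 \<le> k" "k \<le> m" for k
      proof -
        have "G k \<in> borel_measurable (PiM (past_index m) (\<lambda>_. borel))"
          unfolding G_def using step_of_measurable[OF k(2)] by measurable
        moreover have "integrable M (\<lambda>\<omega>. G k (past m \<omega>))" "expectation (\<lambda>\<omega>. G k (past m \<omega>)) = 1"
          using less.IH[of k] k m by (auto simp: GX)
        ultimately show
          "integrable M (\<lambda>\<omega>. of_bool (\<alpha> (Suc m) \<omega>) * of_bool (\<beta> (Suc m) \<omega> = k) * (X k \<omega>)\<^sup>2)"
          "expectation (\<lambda>\<omega>. of_bool (\<alpha> (Suc m) \<omega>) * of_bool (\<beta> (Suc m) \<omega> = k) * (X k \<omega>)\<^sup>2) = p * (\<mu> k / nu \<mu> m)"
          using recall_expectation[OF k, of "G k"] k by (simp_all add: GX)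
      qed
      have sq: "(\<lambda>x::real. x\<^sup>2) \<in> borel_measurable borel" by measurable
      have one: "integrable M (\<lambda>\<omega>. 1 :: real)" by simp
      note E = innovation_expectation[OF m(2) sq xi_sq_integrable borel_measurable_const one]
      have I: "integrable M (\<lambda>\<omega>. (1 - of_bool (\<alpha> (Suc m) \<omega>)) * (\<xi> (Suc m) \<omega>)\<^sup>2)"
        "expectation (\<lambda>\<omega>. (1 - of_bool (\<alpha> (Suc m) \<omega>)) * (\<xi> (Suc m) \<omega>)\<^sup>2) = 1 - p"
        using E by (simp_all only: mult_1_right xi_sq_mean prob_space lebesgue_integral_const real_scaleR_def)
      have "(\<Sum>k=1..m. p * (\<mu> k / nu \<mu> m)) = p"
        using nu_pos[OF m(2)] by (simp add: nu_def flip: sum_distrib_left sum_divide_distrib)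
      moreover have S: "integrable M (\<lambda>\<omega>. \<Sum>k=1..m. of_bool (\<alpha> (Suc m) \<omega>) * of_bool (\<beta> (Suc m) \<omega> = k) * (X k \<omega>)\<^sup>2)"
        by (intro Bochner_Integration.integrable_sum R) auto
      moreover have "expectation (\<lambda>\<omega>. \<Sum>k=1..m. of_bool (\<alpha> (Suc m) \<omega>) * of_bool (\<beta> (Suc m) \<omega> = k) * (X k \<omega>)\<^sup>2)
          = (\<Sum>k=1..m. p * (\<mu> k / nu \<mu> m))"
        by (rule trans[OF Bochner_Integration.integral_sum]; intro sum.cong refl R; simp)
      ultimately show ?thesis
        unfolding m(1) X_Suc_sq[OF m(2)] Bochner_Integration.integral_add[OF S I(1)] I(2)
        using Bochner_Integration.integrable_add[OF S I(1)] by simp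
    qed
  qed
  then show "integrable M (\<lambda>\<omega>. (X n \<omega>)\<^sup>2)" "expectation (\<lambda>\<omega>. (X n \<omega>)\<^sup>2) = 1" by auto
qed

section \<open>Mixed second moments of weighted sums of the steps\<close>

definition comb :: "(nat \<Rightarrow> real) \<Rightarrow> nat \<Rightarrow> 'a \<Rightarrow> real" where
  "comb c n \<omega> = (\<Sum>k=1..n. c k * X k \<omega>)"

lemma walk_eq_comb: "walk \<xi> \<alpha> \<beta> n = comb (\<lambda>_. 1) n"
  by (simp add: walk_def comb_def X_def fun_eq_iff)

lemma comb_Suc: "comb c (Suc n) \<omega> = comb c n \<omega> + c (Suc n) * X (Suc n) \<omega>"
  by (simp add: comb_def)

lemma integrable_X_mult_X:
  assumes "i \<ge> 1" "j \<ge> 1"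
  shows "integrable M (\<lambda>\<omega>. X i \<omega> * X j \<omega>)"
proof (rule Bochner_Integration.integrable_bound)
  show "integrable M (\<lambda>\<omega>. (X i \<omega>)\<^sup>2 + (X j \<omega>)\<^sup>2)"
    using assms X_second_moment by auto
  have "\<bar>x * y\<bar> \<le> x\<^sup>2 + y\<^sup>2" for x y :: real
    using sum_squares_bound[of "\<bar>x\<bar>" "\<bar>y\<bar>"] abs_ge_zero[of "x * y"]
    unfolding abs_mult power2_abs by linarith
  then show "AE \<omega> in M. norm (X i \<omega> * X j \<omega>) \<le> norm ((X i \<omega>)\<^sup>2 + (X j \<omega>)\<^sup>2)"
    by (intro AE_I2) simp
qed simp

lemma integrable_X_mult_comb:
  "i \<ge> 1 \<Longrightarrow> integrable M (\<lambda>\<omega>. X i \<omega> * comb c n \<omega>)"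
  unfolding comb_def sum_distrib_left
  by (intro Bochner_Integration.integrable_sum)
    (auto simp: mult.left_commute[of "X i _"] intro!: integrable_mult_right integrable_X_mult_X)

lemma integrable_comb_mult_comb: "integrable M (\<lambda>\<omega>. comb c n \<omega> * comb d m \<omega>)"
  unfolding comb_def[of c] sum_distrib_right
  by (intro Bochner_Integration.integrable_sum)
    (auto simp: mult.assoc intro!: integrable_mult_right integrable_X_mult_comb)

lemma integrable_comb: "integrable M (comb c n)"
proof (rule square_integrable_imp_integrable)
  show "comb c n \<in> borel_measurable M" unfolding comb_def by measurable
  show "integrable M (\<lambda>\<omega>. (comb c n \<omega>)\<^sup>2)"
    using integrable_comb_mult_comb[of c n c n] by (simp add: power2_eq_square)
qed

text \<open>With weights \<open>\<mu>\<close> and 1 this covers the walk, the sum governing the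
  conditional mean of the next step, and their mixed moment, so that a single recursion serves all
  three.\<close>

definition mom :: "(nat \<Rightarrow> real) \<Rightarrow> (nat \<Rightarrow> real) \<Rightarrow> nat \<Rightarrow> real" where
  "mom c d n = expectation (\<lambda>\<omega>. comb c n \<omega> * comb d n \<omega>)"

text \<open>Given the past, the next step has conditional mean \<open>p / nu \<mu> n * comb \<mu> n\<close>.\<close>
lemma expectation_X_Suc_mult_comb:
  assumes n: "n \<ge> 1"
  shows "expectation (\<lambda>\<omega>. X (Suc n) \<omega> * comb c n \<omega>) = p / nu \<mu> n * mom \<mu> c n"
proof -
  define G where "G z = (\<Sum>j=1..n. c j * step_of j z)" for z
  have G [measurable]: "G \<in> borel_measurable (PiM (past_index n) (\<lambda>_. borel))"
    unfolding G_def by (intro borel_measurable_sum borel_measurable_times step_of_measurable) auto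
  have Gc: "G (past n \<omega>) = comb c n \<omega>" for \<omega>
    unfolding G_def comb_def by (intro sum.cong) (auto simp: X_eq_step_of[symmetric])
  have R: "integrable M (\<lambda>\<omega>. of_bool (\<alpha> (Suc n) \<omega>) * of_bool (\<beta> (Suc n) \<omega> = k) * (X k \<omega> * comb c n \<omega>))"
    "expectation (\<lambda>\<omega>. of_bool (\<alpha> (Suc n) \<omega>) * of_bool (\<beta> (Suc n) \<omega> = k) * (X k \<omega> * comb c n \<omega>)) =
       p * (\<mu> k / nu \<mu> n) * expectation (\<lambda>\<omega>. X k \<omega> * comb c n \<omega>)" if k: "1 \<le> k" "k \<le> n" for k
  proof -
    have [measurable]: "step_of k \<in> borel_measurable (PiM (past_index n) (\<lambda>_. borel))"
      by (rule step_of_measurable[OF k(2)])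
    have "(\<lambda>z. step_of k z * G z) \<in> borel_measurable (PiM (past_index n) (\<lambda>_. borel))" by measurable
    from recall_expectation[OF k this] integrable_X_mult_comb[OF k(1), of c n]
    show "integrable M (\<lambda>\<omega>. of_bool (\<alpha> (Suc n) \<omega>) * of_bool (\<beta> (Suc n) \<omega> = k) * (X k \<omega> * comb c n \<omega>))"
      "expectation (\<lambda>\<omega>. of_bool (\<alpha> (Suc n) \<omega>) * of_bool (\<beta> (Suc n) \<omega> = k) * (X k \<omega> * comb c n \<omega>)) =
       p * (\<mu> k / nu \<mu> n) * expectation (\<lambda>\<omega>. X k \<omega> * comb c n \<omega>)"
      using k by (simp_all add: Gc X_eq_step_of[OF k(2), symmetric])
  qed
  have I: "integrable M (\<lambda>\<omega>. (1 - of_bool (\<alpha> (Suc n) \<omega>)) * \<xi> (Suc n) \<omega> * comb c n \<omega>)"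
    "expectation (\<lambda>\<omega>. (1 - of_bool (\<alpha> (Suc n) \<omega>)) * \<xi> (Suc n) \<omega> * comb c n \<omega>) = 0"
  proof -
    have h: "(\<lambda>x::real. x) \<in> borel_measurable borel" by measurable
    have Gi: "integrable M (\<lambda>\<omega>. G (past n \<omega>))" unfolding Gc by (rule integrable_comb)
    note E = innovation_expectation[OF n h xi_integrable G Gi]
    show "integrable M (\<lambda>\<omega>. (1 - of_bool (\<alpha> (Suc n) \<omega>)) * \<xi> (Suc n) \<omega> * comb c n \<omega>)"
      "expectation (\<lambda>\<omega>. (1 - of_bool (\<alpha> (Suc n) \<omega>)) * \<xi> (Suc n) \<omega> * comb c n \<omega>) = 0"
      using E by (simp_all only: Gc xi_mean mult_zero_right mult_zero_left)
  qed
  have "expectation (\<lambda>\<omega>. X (Suc n) \<omega> * comb c n \<omega>) =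
     expectation (\<lambda>\<omega>. (\<Sum>k=1..n. of_bool (\<alpha> (Suc n) \<omega>) * of_bool (\<beta> (Suc n) \<omega> = k) * (X k \<omega> * comb c n \<omega>)) +
       (1 - of_bool (\<alpha> (Suc n) \<omega>)) * \<xi> (Suc n) \<omega> * comb c n \<omega>)"
    by (simp only: X_Suc[OF n] distrib_right sum_distrib_right mult.assoc)
  also have "\<dots> = (\<Sum>k=1..n. p * (\<mu> k / nu \<mu> n) * expectation (\<lambda>\<omega>. X k \<omega> * comb c n \<omega>))"
  proof -
    have S: "integrable M (\<lambda>\<omega>. \<Sum>k=1..n. of_bool (\<alpha> (Suc n) \<omega>) * of_bool (\<beta> (Suc n) \<omega> = k) * (X k \<omega> * comb c n \<omega>))"
      by (intro Bochner_Integration.integrable_sum R) auto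
    show ?thesis
      unfolding Bochner_Integration.integral_add[OF S I(1)] I(2) add_0_right
      by (rule trans[OF Bochner_Integration.integral_sum]; intro sum.cong refl R; simp)
  qed
  also have "\<dots> = p / nu \<mu> n * (\<Sum>k=1..n. expectation (\<lambda>\<omega>. \<mu> k * (X k \<omega> * comb c n \<omega>)))"
    by (simp add: sum_distrib_left mult.assoc)
  also have "(\<Sum>k=1..n. expectation (\<lambda>\<omega>. \<mu> k * (X k \<omega> * comb c n \<omega>))) =
      expectation (\<lambda>\<omega>. \<Sum>k=1..n. \<mu> k * (X k \<omega> * comb c n \<omega>))"
    by (rule Bochner_Integration.integral_sum[symmetric])
      (auto intro!: integrable_mult_right integrable_X_mult_comb)
  also have "\<dots> = mom \<mu> c n"
    by (simp add: mom_def comb_def[of \<mu>] sum_distrib_right mult.assoc)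
  finally show ?thesis .
qed

lemma mom_1: "mom c d 1 = c 1 * d 1"
proof -
  have "mom c d 1 = expectation (\<lambda>\<omega>. c 1 * d 1 * (X 1 \<omega>)\<^sup>2)"
    by (simp add: mom_def comb_def power2_eq_square mult_ac)
  then show ?thesis using X_second_moment(2)[of 1] by simp
qed

text \<open>Bilinear expansion; the last term uses that a step has second moment 1. Besides the old
  value only moments with one weight equal to \<open>\<mu>\<close> occur, which makes the system for
  the weights \<open>\<mu>\<close> and 1 closed and triangular.\<close>

lemma mom_Suc:
  assumes n: "n \<ge> 1"
  shows "mom c d (Suc n) = mom c d n + d (Suc n) * (p / nu \<mu> n) * mom \<mu> c n
    + c (Suc n) * (p / nu \<mu> n) * mom \<mu> d n + c (Suc n) * d (Suc n)"
proof -
  have "mom c d (Suc n) = expectation (\<lambda>\<omega>. comb c n \<omega> * comb d n \<omega> + d (Suc n) * (X (Suc n) \<omega> * comb c n \<omega>)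
      + c (Suc n) * (X (Suc n) \<omega> * comb d n \<omega>) + c (Suc n) * d (Suc n) * (X (Suc n) \<omega>)\<^sup>2)"
    unfolding mom_def comb_Suc by (simp add: algebra_simps power2_eq_square)
  also have "\<dots> = mom c d n + d (Suc n) * expectation (\<lambda>\<omega>. X (Suc n) \<omega> * comb c n \<omega>)
     + c (Suc n) * expectation (\<lambda>\<omega>. X (Suc n) \<omega> * comb d n \<omega>) + c (Suc n) * d (Suc n)"
    using X_second_moment[of "Suc n"] integrable_comb_mult_comb integrable_X_mult_comb
    by (simp add: mom_def)
  finally show ?thesis
    by (simp add: expectation_X_Suc_mult_comb[OF n])
qed

end

section \<open>Asymptotics of the second moments\<close>

text \<open>With \<open>Y n = (\<Sum>k=1..n. \<mu> k * X k)\<close>, the sequences \<open>A\<close>, \<open>B\<close>, \<open>C\<close> are the expectations of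
  \<open>(Y n)\<^sup>2\<close>, \<open>Y n * S n\<close> and \<open>(S n)\<^sup>2\<close>.\<close>
locale rv_moments = rv_weights \<gamma> \<mu> for \<gamma> :: real and \<mu> :: "nat \<Rightarrow> real" +
  fixes p :: real and A B C :: "nat \<Rightarrow> real"
  assumes p_range: "0 \<le> p" "p \<le> 1"
    and A_1: "A 1 = (\<mu> 1)\<^sup>2" and B_1: "B 1 = \<mu> 1" and C_1: "C 1 = 1"
    and A_Suc: "\<And>n. n \<ge> 1 \<Longrightarrow> A (Suc n) = (1 + 2 * p * (\<mu> (Suc n) / \<nu> n)) * A n + (\<mu> (Suc n))\<^sup>2"
    and B_Suc: "\<And>n. n \<ge> 1 \<Longrightarrow> B (Suc n) = (1 + p * (\<mu> (Suc n) / \<nu> n)) * B n + (p * A n / \<nu> n + \<mu> (Suc n))"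
    and C_Suc: "\<And>n. n \<ge> 1 \<Longrightarrow> C (Suc n) = C n + (2 * p * B n / \<nu> n + 1)"
begin

definition g :: real where "g = \<gamma> + 1"

abbreviation q where "q n \<equiv> \<mu> (Suc n) / \<nu> n"

lemma g_pos: "g > 0"
  using gamma_gt by (simp add: g_def)

lemma q_pos: "n \<ge> 1 \<Longrightarrow> q n > 0"
  by (simp add: mu_pos nu_pos)

lemma pq_nonneg: "n \<ge> 1 \<Longrightarrow> 0 \<le> p * q n"
  by (intro mult_nonneg_nonneg p_range less_imp_le[OF q_pos])

lemma A_nonneg: "n \<ge> 1 \<Longrightarrow> A n \<ge> 0"
proof (induction rule: dec_induct)
  case (step n)
  then show ?case
    unfolding A_Suc[OF step(1)] using q_pos[OF step(1)] p_range
    by (intro add_nonneg_nonneg mult_nonneg_nonneg zero_le_power2) auto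
qed (simp only: A_1 zero_le_power2)

lemma B_nonneg: "n \<ge> 1 \<Longrightarrow> B n \<ge> 0"
proof (induction rule: dec_induct)
  case (step n)
  have "0 \<le> (1 + p * q n) * B n"
    using q_pos[OF step(1)] p_range step by (intro add_nonneg_nonneg mult_nonneg_nonneg) auto
  moreover have "0 \<le> p * A n / \<nu> n" using p_range A_nonneg[of n] step nu_nonneg[of n] by simp
  ultimately show ?case using mu_pos[of "Suc n"] step by (simp add: B_Suc)
qed (simp only: B_1 less_imp_le[OF mu_pos] order_refl)

lemma C_nonneg: "n \<ge> 1 \<Longrightarrow> C n \<ge> 0"
proof (induction rule: dec_induct)
  case (step n)
  have "0 \<le> 2 * p * B n / \<nu> n" using p_range B_nonneg[of n] step nu_nonneg[of n] by simp
  then show ?case using step by (simp add: C_Suc)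
qed (simp only: C_1 zero_le_one)

section \<open>The indices of \<open>\<nu>\<close> and \<open>aseq\<close>\<close>

lemma shift_quotient: "(\<lambda>n. real n / real (Suc n)) \<longlonglongrightarrow> 1"
  by (rule LIMSEQ_n_over_Suc_n)

lemma ratio_Suc_tendsto: "(\<lambda>n. ratio (Suc n)) \<longlonglongrightarrow> g"
  unfolding g_def by (rule LIMSEQ_Suc[OF ratio_tendsto])

text \<open>Karamata's quotient divides by \<open>\<nu> (Suc n)\<close> and the recursions by
  \<open>\<nu> n\<close>; the correction is
  \<open>\<nu> n / \<nu> (Suc n) = 1 - ratio (Suc n) / (n + 1)\<close>, which tends to 1.\<close>

lemma q_eq: "n \<ge> 1 \<Longrightarrow> real n * q n = (real n / real (Suc n)) * ratio (Suc n) * inverse (1 - ratio (Suc n) * (1 / real (Suc n)))"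
proof -
  assume n: "n \<ge> 1"
  have "1 - ratio (Suc n) * (1 / real (Suc n)) = 1 - \<mu> (Suc n) / \<nu> (Suc n)"
    by (simp add: ratio_def del: of_nat_Suc)
  also have "\<dots> = \<nu> n / \<nu> (Suc n)"
    using nu_pos[of "Suc n"] by (simp add: nu_Suc field_simps)
  finally have "1 - ratio (Suc n) * (1 / real (Suc n)) = \<nu> n / \<nu> (Suc n)" .
  then show ?thesis
    using n nu_pos[of n] nu_pos[of "Suc n"] by (simp add: ratio_def del: of_nat_Suc)
qed

lemma q_tendsto: "(\<lambda>n. real n * q n) \<longlonglongrightarrow> g"
proof -
  have "(\<lambda>n. (real n / real (Suc n)) * ratio (Suc n) * inverse (1 - ratio (Suc n) * (1 / real (Suc n)))) \<longlonglongrightarrow>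
      1 * g * inverse (1 - g * 0)"
    by (intro tendsto_intros shift_quotient ratio_Suc_tendsto LIMSEQ_Suc[OF lim_1_over_n]) simp
  then have "(\<lambda>n. (real n / real (Suc n)) * ratio (Suc n) * inverse (1 - ratio (Suc n) * (1 / real (Suc n)))) \<longlonglongrightarrow> g"
    by simp
  moreover have "\<forall>\<^sub>F n in sequentially. (real n / real (Suc n)) * ratio (Suc n) * inverse (1 - ratio (Suc n) * (1 / real (Suc n))) = real n * q n"
    using eventually_ge_at_top[of 1] by eventually_elim (rule q_eq[symmetric])
  ultimately show ?thesis by (rule Lim_transform_eventually)
qed

lemma q_mult_tendsto: "(\<lambda>n. real n * (c * q n)) \<longlonglongrightarrow> c * g"
  using tendsto_mult_left[OF q_tendsto, of c] by (simp only: mult.left_commute)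

lemma has_index_nu: "has_index \<nu> g"
proof (rule has_indexI[OF _ q_tendsto])
  show "\<nu> (Suc n) / \<nu> n = 1 + q n" if "n \<ge> 1" for n
    using nu_pos[OF that] by (simp add: nu_Suc add_divide_distrib)
qed (rule nu_pos)

abbreviation a where "a \<equiv> aseq p \<mu>"

lemma a_pos: "n \<ge> 1 \<Longrightarrow> a n > 0"
  unfolding aseq_def
proof (intro prod_pos ballI)
  fix i assume "i \<in> {1..<n}"
  then have "0 \<le> p * q i" by (intro pq_nonneg) simp
  then show "0 < inverse (1 + p * (\<mu> (i + 1) / \<nu> i))" by simp
qed

lemma a_Suc: "n \<ge> 1 \<Longrightarrow> a (Suc n) = a n * inverse (1 + p * q n)"
  by (simp add: aseq_def)

lemma has_index_a: "has_index a (- (p * g))"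
proof -
  have "has_index (\<lambda>n. inverse (a n)) (p * g)"
  proof (rule has_indexI[OF _ q_mult_tendsto])
    show "inverse (a (Suc n)) / inverse (a n) = 1 + p * q n" if "n \<ge> 1" for n
      using a_pos[OF that] by (simp add: a_Suc[OF that])
  qed (simp add: a_pos)
  from has_index_inverse[OF this] show ?thesis by simp
qed

section \<open>Moments below the critical value\<close>

lemma subcritical:
  assumes sub: "2 * g * (1 - p) > 1"
  shows "(\<lambda>n. C n / real n) \<longlonglongrightarrow> 1 + 2 * p * ((p * (g\<^sup>2 / (2 * g * (1 - p) - 1)) + g) / (g * (1 - p)))"
proof -
  have p1: "p < 1" using sub p_range by (cases "p = 1") auto
  let ?\<alpha> = "g\<^sup>2 / (2 * g * (1 - p) - 1)"
  let ?b = "(p * ?\<alpha> + g) / (g * (1 - p))"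
  have ratio2: "(\<lambda>n. real n / real (Suc n) * (ratio (Suc n))\<^sup>2) \<longlonglongrightarrow> g\<^sup>2"
    using tendsto_mult[OF shift_quotient tendsto_power[OF ratio_Suc_tendsto, of 2]] by simp
  \<comment> \<open>The normaliser has index \<open>1 - 2 * g\<close> and the recursion contributes
    \<open>2 * p * g\<close>, so the rate is \<open>2 * g * (1 - p) - 1\<close>, positive by
    \<open>sub\<close>; the source tends to \<open>g\<^sup>2\<close>.\<close>
  have A: "(\<lambda>n. real n / (\<nu> n)\<^sup>2 * A n) \<longlonglongrightarrow> ?\<alpha>"
  proof -
    have "(\<lambda>n. real n / (\<nu> n)\<^sup>2 * A n) \<longlonglongrightarrow> g\<^sup>2 / - (1 - 2 * g + 2 * p * g)"
    proof (rule scaled_recursion_tendsto[OF has_index_divide[OF has_index_real has_index_power2[OF has_index_nu]]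
          q_mult_tendsto])
      have "real n / real (Suc n) * (ratio (Suc n))\<^sup>2 = real n * (real (Suc n) / (\<nu> (Suc n))\<^sup>2) * (\<mu> (Suc n))\<^sup>2" for n
        using nu_pos[of "Suc n"] by (simp add: ratio_def power2_eq_square field_simps del: of_nat_Suc)
      then show "(\<lambda>n. real n * (real (Suc n) / (\<nu> (Suc n))\<^sup>2) * (\<mu> (Suc n))\<^sup>2) \<longlonglongrightarrow> g\<^sup>2"
        using ratio2 by simp
      show "1 - 2 * g + 2 * p * g < 0" using sub by (simp add: algebra_simps)
    qed (rule A_Suc)
    also have "- (1 - 2 * g + 2 * p * g) = 2 * g * (1 - p) - 1" by (simp add: algebra_simps)
    finally show ?thesis .
  qed
  \<comment> \<open>The rate is \<open>g * (1 - p)\<close>. The source has the contribution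
    \<open>p * ?\<alpha>\<close> of the preceding moment and \<open>g\<close> of the new
    weight.\<close>
  have B: "(\<lambda>n. inverse (\<nu> n) * B n) \<longlonglongrightarrow> ?b"
  proof -
    have "(\<lambda>n. inverse (\<nu> n) * B n) \<longlonglongrightarrow> (p * ?\<alpha> + g) / - (- g + p * g)"
    proof (rule scaled_recursion_tendsto[OF has_index_inverse[OF has_index_nu] q_mult_tendsto])
      have "(\<lambda>n. p * (real n / (\<nu> n)\<^sup>2 * A n) * (\<nu> n / \<nu> (Suc n)) + real n / real (Suc n) * ratio (Suc n)) \<longlonglongrightarrow>
          p * ?\<alpha> * 1 + 1 * g"
        by (intro tendsto_add tendsto_mult tendsto_const A has_index_quotient'[OF has_index_nu] shift_quotient ratio_Suc_tendsto)
      then have "(\<lambda>n. p * (real n / (\<nu> n)\<^sup>2 * A n) * (\<nu> n / \<nu> (Suc n)) + real n / real (Suc n) * ratio (Suc n)) \<longlonglongrightarrow>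
          p * ?\<alpha> + g" by (simp only: mult_1_right mult_1_left)
      moreover have "\<forall>\<^sub>F n in sequentially. p * (real n / (\<nu> n)\<^sup>2 * A n) * (\<nu> n / \<nu> (Suc n)) + real n / real (Suc n) * ratio (Suc n)
          = real n * inverse (\<nu> (Suc n)) * (p * A n / \<nu> n + \<mu> (Suc n))"
        using eventually_ge_at_top[of 1]
      proof eventually_elim
        case (elim n)
        then show ?case using nu_pos[of n] nu_pos[of "Suc n"]
          by (simp add: ratio_def power2_eq_square field_simps del: of_nat_Suc)
      qed
      ultimately show "(\<lambda>n. real n * inverse (\<nu> (Suc n)) * (p * A n / \<nu> n + \<mu> (Suc n))) \<longlonglongrightarrow> p * ?\<alpha> + g"
        by (rule Lim_transform_eventually)
      have "p * g < 1 * g" using p1 g_pos by (intro mult_strict_right_mono)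
      then show "- g + p * g < 0" by simp
    qed (rule B_Suc)
    also have "- (- g + p * g) = g * (1 - p)" by (simp add: algebra_simps)
    finally show ?thesis .
  qed
  have "(\<lambda>n. inverse (real n) * C n) \<longlonglongrightarrow> (2 * p * ?b + 1) / - (- 1 + 0)"
  proof (rule scaled_recursion_tendsto[OF has_index_inverse[OF has_index_real], of "\<lambda>_. 0"])
    have "(\<lambda>n. real n / real (Suc n) * (2 * p * (inverse (\<nu> n) * B n) + 1)) \<longlonglongrightarrow> 1 * (2 * p * ?b + 1)"
      by (intro tendsto_add tendsto_mult tendsto_const B shift_quotient)
    then show "(\<lambda>n. real n * inverse (real (Suc n)) * (2 * p * B n / \<nu> n + 1)) \<longlonglongrightarrow> 2 * p * ?b + 1"
      by (simp only: mult_1_left divide_inverse mult_ac)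
  qed (auto simp: C_Suc)
  then show ?thesis by (simp add: divide_inverse mult_ac add_ac)
qed

section \<open>The martingale part and its variance bound \<open>Q\<close>, the square of
  \<open>vseq\<close>\<close>

definition Q :: "nat \<Rightarrow> real" where
  "Q n = (\<Sum>k=1..n. (a k)\<^sup>2 * (\<mu> k)\<^sup>2)"

text \<open>Up to the convergent factor \<^const>\<open>ratio\<close>, \<open>u n\<close> is \<open>a n * \<mu> n\<close>; unlike \<open>\<mu>\<close> itself it has an index.\<close>
definition u :: "nat \<Rightarrow> real" where
  "u n = a n * \<nu> n / real n"

lemma Q_Suc: "Q (Suc n) = Q n + (a (Suc n) * \<mu> (Suc n))\<^sup>2"
  by (simp add: Q_def power_mult_distrib)

lemma Q_pos: "n \<ge> 1 \<Longrightarrow> Q n > 0"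
  unfolding Q_def
  by (intro sum_pos mult_pos_pos zero_less_power a_pos mu_pos) auto

lemma Q_mono: "m \<le> n \<Longrightarrow> Q m \<le> Q n"
  unfolding Q_def by (intro sum_mono2) auto

lemma u_pos: "n \<ge> 1 \<Longrightarrow> u n > 0"
  by (simp add: u_def a_pos nu_pos)

lemma has_index_u: "has_index u (g * (1 - p) - 1)"
  using has_index_divide[OF has_index_mult[OF has_index_a has_index_nu] has_index_real]
  by (simp add: u_def[abs_def] algebra_simps)

lemma weight_eq: "n \<ge> 1 \<Longrightarrow> a n * \<mu> n = ratio n * u n"
  using nu_pos[of n] by (simp add: ratio_def u_def)

lemma weight_Suc_sq: "real n * (a (Suc n) * \<mu> (Suc n))\<^sup>2 =
    real n / real (Suc n) * (ratio (Suc n))\<^sup>2 * (real (Suc n) * (u (Suc n))\<^sup>2)"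
  by (simp add: weight_eq power_mult_distrib)

lemma weighted_A_Suc:
  assumes "n \<ge> 1"
  shows "(a (Suc n))\<^sup>2 * A (Suc n) = (a n)\<^sup>2 * A n * ((1 + 2 * p * q n) / (1 + p * q n)\<^sup>2) + (a (Suc n) * \<mu> (Suc n))\<^sup>2"
proof -
  have "(a (Suc n))\<^sup>2 = (a n)\<^sup>2 / (1 + p * q n)\<^sup>2"
    by (simp add: a_Suc[OF assms] power_mult_distrib power_inverse divide_inverse)
  then have "(a (Suc n))\<^sup>2 * ((1 + 2 * p * q n) * A n) = (a n)\<^sup>2 * A n * ((1 + 2 * p * q n) / (1 + p * q n)\<^sup>2)"
    by simp
  then show ?thesis
    by (simp only: A_Suc[OF assms] distrib_left power_mult_distrib)
qed

text \<open>With \<open>x = p * q n\<close> the quotient equals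
  \<open>1 - x\<^sup>2 / (1 + x)\<^sup>2\<close>. As \<open>q n\<close> is of order 1/n, the
  proportion lost at each time is summable.\<close>

lemma one_plus_pq:
  assumes n: "n \<ge> 1"
  shows "(1 + 2 * p * q n) / (1 + p * q n)\<^sup>2 \<le> 1"
    and "(1 + 2 * p * q n) / (1 + p * q n)\<^sup>2 \<ge> 1 - (q n)\<^sup>2"
proof -
  define x where "x = p * q n"
  have x: "x \<ge> 0" "x \<le> q n"
    using pq_nonneg[OF n] mult_right_mono[OF p_range(2) less_imp_le[OF q_pos[OF n]]] by (simp_all add: x_def)
  have eq: "(1 + 2 * p * q n) / (1 + p * q n)\<^sup>2 = 1 - x\<^sup>2 / (1 + x)\<^sup>2"
  proof -
    have "1 + 2 * x = (1 + x)\<^sup>2 - x\<^sup>2" by (simp add: power2_eq_square algebra_simps)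
    then have "(1 + 2 * x) / (1 + x)\<^sup>2 = 1 - x\<^sup>2 / (1 + x)\<^sup>2"
      using x by (simp add: diff_divide_distrib)
    then show ?thesis by (simp only: x_def mult.assoc)
  qed
  show "(1 + 2 * p * q n) / (1 + p * q n)\<^sup>2 \<le> 1"
    unfolding eq by simp
  have "x\<^sup>2 / (1 + x)\<^sup>2 \<le> x\<^sup>2 / 1"
    using x by (intro divide_left_mono one_le_power) auto
  also have "\<dots> \<le> (q n)\<^sup>2"
    using x by (simp add: power_mono)
  finally show "(1 + 2 * p * q n) / (1 + p * q n)\<^sup>2 \<ge> 1 - (q n)\<^sup>2"
    unfolding eq by simp
qed

text \<open>\<open>a n * (\<Sum>k=1..n. \<mu> k * X k)\<close> is a martingale, so its second moment is at most the sum of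
  the second moments \<open>(a k * \<mu> k)\<^sup>2\<close> bounding those of its increments.\<close>
lemma weighted_A_le: "n \<ge> 1 \<Longrightarrow> (a n)\<^sup>2 * A n \<le> Q n"
proof (induction rule: dec_induct)
  case base
  show ?case unfolding A_1 by (simp add: Q_def)
next
  case (step n)
  have "(a n)\<^sup>2 * A n * ((1 + 2 * p * q n) / (1 + p * q n)\<^sup>2) \<le> (a n)\<^sup>2 * A n * 1"
    using one_plus_pq(1)[of n] A_nonneg[of n] step by (intro mult_left_mono) auto
  with step show ?case by (simp add: weighted_A_Suc Q_Suc)
qed

text \<open>Up to a convergent factor this is n (a_n mu_n)^2, so \<open>\<tau> n / n\<close>
  measures the increments of \<open>Q\<close>. The sign of its index tells whether \<open>p\<close>
  is below, at or above the critical value.\<close>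

definition \<tau> :: "nat \<Rightarrow> real" where
  "\<tau> n = real n * (u n)\<^sup>2"

lemma tau_pos: "n \<ge> 1 \<Longrightarrow> \<tau> n > 0"
  using u_pos[of n] by (simp add: \<tau>_def)

lemma has_index_tau: "has_index \<tau> (2 * g * (1 - p) - 1)"
proof -
  have "1 + 2 * (g * (1 - p) - 1) = 2 * g * (1 - p) - 1" by (simp add: algebra_simps)
  then show ?thesis
    using has_index_mult[OF has_index_real has_index_power2[OF has_index_u]]
    unfolding \<tau>_def[abs_def] by (simp only:)
qed

definition \<kappa> :: "nat \<Rightarrow> real" where
  "\<kappa> n = real n / real (Suc n) * (ratio (Suc n))\<^sup>2"

lemma kappa_tendsto: "\<kappa> \<longlonglongrightarrow> g\<^sup>2"
  using tendsto_mult[OF shift_quotient tendsto_power[OF ratio_Suc_tendsto, of 2]]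
  by (simp add: \<kappa>_def[abs_def])

lemma weight_eq_kappa: "real n * (a (Suc n) * \<mu> (Suc n))\<^sup>2 = \<kappa> n * \<tau> (Suc n)"
  unfolding \<kappa>_def \<tau>_def by (rule weight_Suc_sq)

text \<open>The increment of \<open>Q\<close> is \<open>\<kappa> n * \<tau> (Suc n) / n\<close>, so
  the normalised recursion for \<open>Q / \<tau>\<close> has a forcing that tends to
  \<open>g\<^sup>2\<close>. Half of it is kept as a constant, which suffices for bounding
  \<open>Q / \<tau>\<close> from below whatever the sign of the limiting rate.\<close>

lemma Q_over_tau_recursion:
  obtains d where "d \<longlonglongrightarrow> 2 * g * (1 - p) - 1"
    and "\<forall>\<^sub>F n in sequentially. inverse (\<tau> (Suc n)) * Q (Suc n) \<ge>
      (1 - d n / real n) * (inverse (\<tau> n) * Q n) + (g\<^sup>2 / 2) / real n"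
proof -
  obtain d where d: "d \<longlonglongrightarrow> - (- (2 * g * (1 - p) - 1) + 0)"
    and r: "\<And>n. n \<ge> 1 \<Longrightarrow> Q (Suc n) = (1 + 0) * Q n + (a (Suc n) * \<mu> (Suc n))\<^sup>2 \<Longrightarrow>
       inverse (\<tau> (Suc n)) * Q (Suc n) = (1 - d n / real n) * (inverse (\<tau> n) * Q n) +
         (real n * inverse (\<tau> (Suc n)) * (a (Suc n) * \<mu> (Suc n))\<^sup>2) / real n"
  proof -
    have "(\<lambda>n. real n * 0) \<longlonglongrightarrow> 0" by simp
    from scaled_recursion[OF has_index_inverse[OF has_index_tau] this, where z = Q and
        e = "\<lambda>n. (a (Suc n) * \<mu> (Suc n))\<^sup>2"] that show thesis by blast
  qed
  have "\<forall>\<^sub>F n in sequentially. \<kappa> n > g\<^sup>2 / 2"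
    by (rule order_tendstoD(1)[OF kappa_tendsto]) (use g_pos in simp)
  then have "\<forall>\<^sub>F n in sequentially. inverse (\<tau> (Suc n)) * Q (Suc n) \<ge>
      (1 - d n / real n) * (inverse (\<tau> n) * Q n) + (g\<^sup>2 / 2) / real n"
    using eventually_ge_at_top[of 1]
  proof eventually_elim
    case (elim n)
    have "real n * inverse (\<tau> (Suc n)) * (a (Suc n) * \<mu> (Suc n))\<^sup>2 = \<kappa> n"
      using weight_eq_kappa[of n] tau_pos[of "Suc n"] by (simp add: field_simps)
    then have "inverse (\<tau> (Suc n)) * Q (Suc n) = (1 - d n / real n) * (inverse (\<tau> n) * Q n) + \<kappa> n / real n"
      using r[OF elim(2)] by (simp add: Q_Suc)
    moreover have "(g\<^sup>2 / 2) / real n \<le> \<kappa> n / real n"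
      using elim by (intro divide_right_mono) auto
    ultimately show ?case by linarith
  qed
  with d that show ?thesis by simp
qed

text \<open>The defect accumulated after time \<open>m\<close> is at most \<open>Q n\<close> times
  the tail of a convergent series, and the defect before \<open>m\<close> is at most
  \<open>Q m\<close>, which is negligible because \<open>Q\<close> diverges.\<close>

lemma weighted_A_tendsto:
  assumes Q: "filterlim Q at_top sequentially"
  shows "(\<lambda>n. (a n)\<^sup>2 * A n / Q n) \<longlonglongrightarrow> 1"
proof -
  define K where "K = (g + 1)\<^sup>2"
  have "\<forall>\<^sub>F n in sequentially. real n * q n < g + 1"
    by (rule order_tendstoD(2)[OF q_tendsto]) simp
  then obtain N where N: "\<And>n. n \<ge> N \<Longrightarrow> real n * q n < g + 1" by (auto simp: eventually_sequentially)
  have q2: "(q n)\<^sup>2 \<le> K / (real n)\<^sup>2" if "n \<ge> max N 1" for n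
  proof -
    have "(real n * q n)\<^sup>2 \<le> (g + 1)\<^sup>2"
      using N[of n] q_pos[of n] that by (intro power_mono mult_nonneg_nonneg) (auto simp: less_imp_le)
    then have "(real n)\<^sup>2 * (q n)\<^sup>2 \<le> K" unfolding K_def power_mult_distrib .
    then show ?thesis using that by (simp add: pos_le_divide_eq mult.commute)
  qed
  text \<open>The defect \<open>Q n - (a n)\<^sup>2 * A n\<close> grows only by \<open>Q n * O(1/n\<^sup>2)\<close>.\<close>
  have defect: "Q n - (a n)\<^sup>2 * A n \<le> Q m + Q n * (K * (1 / (real m - 1) - 1 / (real n - 1)))"
    if m: "m \<ge> max N 2" and n: "n \<ge> m" for m n
    using n
  proof (induction rule: dec_induct)
    case base
    show ?case using A_nonneg[of m] m by simp
  next
    case (step n)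
    have n2: "n \<ge> 2" and n1: "n \<ge> 1" using step m by auto
    have K0: "K \<ge> 0" by (simp add: K_def)
    have P0: "0 \<le> (a n)\<^sup>2 * A n" using A_nonneg[OF n1] by simp
    have "(a n)\<^sup>2 * A n * (1 - (q n)\<^sup>2) \<le> (a n)\<^sup>2 * A n * ((1 + 2 * p * q n) / (1 + p * q n)\<^sup>2)"
      using one_plus_pq(2)[OF n1] P0 by (intro mult_left_mono)
    then have "Q (Suc n) - (a (Suc n))\<^sup>2 * A (Suc n) \<le> Q n - (a n)\<^sup>2 * A n + (a n)\<^sup>2 * A n * (q n)\<^sup>2"
      unfolding weighted_A_Suc[OF n1] Q_Suc by (simp add: right_diff_distrib)
    also have "(a n)\<^sup>2 * A n * (q n)\<^sup>2 \<le> Q n * (K / (real n)\<^sup>2)"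
      using weighted_A_le[OF n1] q2[of n] P0 step m by (intro mult_mono) auto
    \<comment> \<open>Replacing 1/n^2 by a telescoping difference gives the closed form of the
      bound; the denominator \<open>n - 1\<close> explains the start at
      \<open>m \<ge> 2\<close>.\<close>
    also have "K / (real n)\<^sup>2 \<le> K * (1 / (real n - 1) - 1 / real n)"
    proof -
      have "1 / (real n)\<^sup>2 \<le> 1 / (real n - 1) - 1 / real n"
        using n2 by (simp add: field_simps power2_eq_square)
      from mult_left_mono[OF this K0] show ?thesis by simp
    qed
    also have "Q n - (a n)\<^sup>2 * A n + Q n * (K * (1 / (real n - 1) - 1 / real n)) \<le>
        Q m + Q n * (K * (1 / (real m - 1) - 1 / (real n - 1))) + Q n * (K * (1 / (real n - 1) - 1 / real n))"
      using step by simp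
    also have "\<dots> = Q m + Q n * (K * (1 / (real m - 1) - 1 / real n))"
      by (simp add: algebra_simps)
    also have "Q n * (K * (1 / (real m - 1) - 1 / real n)) \<le> Q (Suc n) * (K * (1 / (real m - 1) - 1 / real n))"
      using Q_mono[of n "Suc n"] K0 m step
      by (intro mult_right_mono mult_nonneg_nonneg) (auto simp: frac_le)
    finally show ?case
      using Q_pos[OF n1] by (simp add: mult_left_mono)
  qed
  show ?thesis
  proof (rule order_tendstoI)
    fix b :: real assume "1 < b"
    show "\<forall>\<^sub>F n in sequentially. (a n)\<^sup>2 * A n / Q n < b"
      using eventually_ge_at_top[of 1]
    proof eventually_elim
      case (elim n)
      then have "(a n)\<^sup>2 * A n / Q n \<le> 1" using weighted_A_le[of n] Q_pos[of n] by simp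
      then show ?case using \<open>1 < b\<close> by simp
    qed
  next
    fix b :: real assume b: "b < 1"
    \<comment> \<open>The allowance \<open>1 - b\<close> is shared equally: one half bounds the tail
      by the choice of \<open>m\<close>, the other bounds \<open>Q m / Q n\<close> for large
      \<open>n\<close> afterwards.\<close>
    have "(\<lambda>m. K / (real m - 1)) \<longlonglongrightarrow> 0" by real_asymp
    then have "\<forall>\<^sub>F m in sequentially. K / (real m - 1) < (1 - b) / 2"
      by (rule order_tendstoD(2)) (use b in simp)
    then have "\<forall>\<^sub>F m in sequentially. K / (real m - 1) < (1 - b) / 2 \<and> m \<ge> max N 2"
      using eventually_ge_at_top[of "max N 2"] by eventually_elim simp
    then obtain m where m: "K / (real m - 1) < (1 - b) / 2" "m \<ge> max N 2"
      using eventually_happens'[OF sequentially_bot] by blast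
    have "(\<lambda>n. Q m / Q n) \<longlonglongrightarrow> 0"
      by (rule tendsto_divide_0[OF tendsto_const filterlim_at_top_imp_at_infinity[OF Q]])
    then have "\<forall>\<^sub>F n in sequentially. Q m / Q n < (1 - b) / 2"
      by (rule order_tendstoD(2)) (use b in simp)
    then show "\<forall>\<^sub>F n in sequentially. b < (a n)\<^sup>2 * A n / Q n"
      using eventually_ge_at_top[of m]
    proof eventually_elim
      case (elim n)
      have Qn: "Q n > 0" using elim m by (intro Q_pos) auto
      have "K * (1 / (real m - 1) - 1 / (real n - 1)) \<le> K * (1 / (real m - 1))"
        using elim m by (intro mult_left_mono) (auto simp: K_def)
      also have "\<dots> < (1 - b) / 2" using m by simp
      finally have "K * (1 / (real m - 1) - 1 / (real n - 1)) < (1 - b) / 2" .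
      then have "Q n * (K * (1 / (real m - 1) - 1 / (real n - 1))) < Q n * ((1 - b) / 2)"
        using Qn by (rule mult_strict_left_mono)
      moreover have "Q m < (1 - b) / 2 * Q n"
        using elim(1) Qn by (simp add: pos_divide_less_eq)
      moreover have "Q n * ((1 - b) / 2) + (1 - b) / 2 * Q n = Q n - b * Q n"
        by (simp add: field_simps)
      ultimately have "b * Q n < (a n)\<^sup>2 * A n"
        using defect[OF m(2) elim(2)] by linarith
      then show ?case using Qn by (simp add: pos_less_divide_eq)
    qed
  qed
qed

text \<open>Here \<open>\<tau>\<close> is negligible against \<open>Q\<close>. The sources
  \<open>\<mu> (Suc n)\<close> and \<open>1\<close> acquire the factor \<open>\<tau> / Q\<close>
  after normalisation and disappear; the remaining sources are \<open>p\<close> with rate 1/2 and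
  \<open>2 * p * (2 * p)\<close> with rate 1.\<close>

lemma critical:
  assumes crit: "2 * g * (1 - p) = 1" and Q: "filterlim Q at_top sequentially"
  shows "(\<lambda>n. (u n)\<^sup>2 / Q n * C n) \<longlonglongrightarrow> 4 * p\<^sup>2"
proof -
  have pg: "g * (1 - p) = 1 / 2" using crit by simp
  have "filterlim (\<lambda>n. inverse (\<tau> n) * Q n) at_top sequentially"
  proof -
    obtain d where "d \<longlonglongrightarrow> 2 * g * (1 - p) - 1"
      and r: "\<forall>\<^sub>F n in sequentially. inverse (\<tau> (Suc n)) * Q (Suc n) \<ge>
        (1 - d n / real n) * (inverse (\<tau> n) * Q n) + (g\<^sup>2 / 2) / real n"
      using Q_over_tau_recursion by blast
    then have "d \<longlonglongrightarrow> 0" using crit by simp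
    then show ?thesis
    proof (rule recursion_at_top[OF _ _ _ r])
      show "inverse (\<tau> n) * Q n \<ge> 0" if "n \<ge> 1" for n
        using tau_pos[OF that] Q_pos[OF that] by simp
    qed (use g_pos in simp)
  qed
  from tendsto_inverse_0_at_top[OF this] have tauQ: "(\<lambda>n. \<tau> n / Q n) \<longlonglongrightarrow> 0"
    by (simp add: divide_inverse)
  \<comment> \<open>The relative increment of \<open>Q\<close> is of size
    \<open>\<tau> n / (n * Q n)\<close>, so division by \<open>Q\<close> does not change the index
    of a normaliser.\<close>
  have Qi: "has_index Q 0"
  proof (rule has_indexI)
    have "(\<lambda>n. \<kappa> n * (\<tau> (Suc n) / \<tau> n) * (\<tau> n / Q n)) \<longlonglongrightarrow> g\<^sup>2 * 1 * 0"
      by (intro tendsto_mult kappa_tendsto has_index_quotient[OF has_index_tau] tauQ)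
    moreover have "\<forall>\<^sub>F n in sequentially. \<kappa> n * (\<tau> (Suc n) / \<tau> n) * (\<tau> n / Q n)
        = real n * ((a (Suc n) * \<mu> (Suc n))\<^sup>2 / Q n)"
      using eventually_ge_at_top[of 1]
    proof eventually_elim
      case (elim n)
      then show ?case using weight_eq_kappa[of n] tau_pos[of n] by simp
    qed
    ultimately show "(\<lambda>n. real n * ((a (Suc n) * \<mu> (Suc n))\<^sup>2 / Q n)) \<longlonglongrightarrow> 0"
      by (auto intro: Lim_transform_eventually)
    show "Q (Suc n) / Q n = 1 + (a (Suc n) * \<mu> (Suc n))\<^sup>2 / Q n" if "n \<ge> 1" for n
      using Q_pos[OF that] by (simp add: Q_Suc add_divide_distrib)
  qed (rule Q_pos)
  have tauQ': "(\<lambda>n. \<tau> (Suc n) / Q (Suc n)) \<longlonglongrightarrow> 0"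
    by (rule LIMSEQ_Suc[OF tauQ])
  note quot = has_index_quotient[OF has_index_a] has_index_quotient[OF has_index_nu]
    has_index_quotient[OF has_index_u] has_index_quotient'[OF Qi]
  have B: "(\<lambda>n. a n * u n / Q n * B n) \<longlonglongrightarrow> 2 * p"
  proof -
    have "(\<lambda>n. a n * u n / Q n * B n) \<longlonglongrightarrow> p / - ((- (p * g) + (g * (1 - p) - 1) - 0) + p * g)"
    proof (rule scaled_recursion_tendsto[OF has_index_divide[OF has_index_mult[OF has_index_a has_index_u] Qi]
          q_mult_tendsto])
      have "(\<lambda>n. p * (real n / real (Suc n)) * (a (Suc n) / a n)\<^sup>2 * (\<nu> (Suc n) / \<nu> n) * ((a n)\<^sup>2 * A n / Q n) * (Q n / Q (Suc n))
          + real n / real (Suc n) * ratio (Suc n) * (\<tau> (Suc n) / Q (Suc n))) \<longlonglongrightarrow>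
          p * 1 * 1\<^sup>2 * 1 * 1 * 1 + 1 * g * 0"
        by (intro tendsto_add tendsto_mult tendsto_const tendsto_power quot shift_quotient
            weighted_A_tendsto[OF Q] ratio_Suc_tendsto tauQ')
      moreover have "\<forall>\<^sub>F n in sequentially.
          p * (real n / real (Suc n)) * (a (Suc n) / a n)\<^sup>2 * (\<nu> (Suc n) / \<nu> n) * ((a n)\<^sup>2 * A n / Q n) * (Q n / Q (Suc n))
          + real n / real (Suc n) * ratio (Suc n) * (\<tau> (Suc n) / Q (Suc n)) =
          real n * (a (Suc n) * u (Suc n) / Q (Suc n)) * (p * A n / \<nu> n + \<mu> (Suc n))"
        using eventually_ge_at_top[of 1]
      proof eventually_elim
        case (elim n)
        then show ?case
          using a_pos[of n] nu_pos[of n] nu_pos[of "Suc n"] Q_pos[of n] Q_pos[of "Suc n"]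
          by (simp add: \<tau>_def u_def ratio_def power2_eq_square field_simps del: of_nat_Suc)
      qed
      ultimately show "(\<lambda>n. real n * (a (Suc n) * u (Suc n) / Q (Suc n)) * (p * A n / \<nu> n + \<mu> (Suc n))) \<longlonglongrightarrow> p"
        by (auto intro: Lim_transform_eventually)
      show "(- (p * g) + (g * (1 - p) - 1) - 0) + p * g < 0" using pg by simp
    qed (rule B_Suc)
    then show ?thesis using pg by (simp add: mult.commute[of 2 p])
  qed
  have "(\<lambda>n. (u n)\<^sup>2 / Q n * C n) \<longlonglongrightarrow> 2 * p * (2 * p) / - (2 * (g * (1 - p) - 1) - 0 + 0)"
  proof (rule scaled_recursion_tendsto[OF has_index_divide[OF has_index_power2[OF has_index_u] Qi], of "\<lambda>_. 0"])
    have "(\<lambda>n. 2 * p * (real n / real (Suc n)) * (a (Suc n) / a n) * (\<nu> (Suc n) / \<nu> n) * (u (Suc n) / u n) * (Q n / Q (Suc n))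
          * (a n * u n / Q n * B n)
        + real n / real (Suc n) * (\<tau> (Suc n) / Q (Suc n))) \<longlonglongrightarrow>
        2 * p * 1 * 1 * 1 * 1 * 1 * (2 * p) + 1 * 0"
      by (intro tendsto_add tendsto_mult tendsto_const quot shift_quotient B tauQ')
    moreover have "\<forall>\<^sub>F n in sequentially.
        2 * p * (real n / real (Suc n)) * (a (Suc n) / a n) * (\<nu> (Suc n) / \<nu> n) * (u (Suc n) / u n) * (Q n / Q (Suc n))
          * (a n * u n / Q n * B n)
        + real n / real (Suc n) * (\<tau> (Suc n) / Q (Suc n)) =
        real n * ((u (Suc n))\<^sup>2 / Q (Suc n)) * (2 * p * B n / \<nu> n + 1)"
      using eventually_ge_at_top[of 1]
    proof eventually_elim
      case (elim n)
      then show ?case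
        using a_pos[of n] nu_pos[of n] Q_pos[of n] Q_pos[of "Suc n"]
        by (simp add: \<tau>_def u_def power2_eq_square field_simps del: of_nat_Suc)
    qed
    ultimately show "(\<lambda>n. real n * ((u (Suc n))\<^sup>2 / Q (Suc n)) * (2 * p * B n / \<nu> n + 1)) \<longlonglongrightarrow> 2 * p * (2 * p)"
      by (auto intro: Lim_transform_eventually)
    show "2 * (g * (1 - p) - 1) - 0 + 0 < 0" using pg by simp
  qed (auto simp: C_Suc)
  then show ?thesis using pg by (simp add: power2_eq_square)
qed

text \<open>Otherwise \<open>\<tau>\<close> has positive index and eventually increases, so the
  increments of \<open>Q\<close> are at least a positive constant over \<open>n\<close> and
  \<open>Q\<close> diverges.\<close>

lemma supercritical_of_bounded:
  assumes V: "\<And>n. Q n \<le> V"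
  shows "2 * g * (1 - p) \<le> 1"
proof (rule ccontr)
  assume "\<not> 2 * g * (1 - p) \<le> 1"
  then have pos: "0 < 2 * g * (1 - p) - 1" by simp
  have "(\<lambda>n. real n * (\<tau> (Suc n) / \<tau> n - 1)) \<longlonglongrightarrow> 2 * g * (1 - p) - 1"
    using has_index_tau by (simp add: has_index_def)
  then have "\<forall>\<^sub>F n in sequentially. 0 < real n * (\<tau> (Suc n) / \<tau> n - 1)"
    by (rule order_tendstoD(1)[OF _ pos])
  then obtain N where N: "\<And>n. n \<ge> N \<Longrightarrow> 0 < real n * (\<tau> (Suc n) / \<tau> n - 1)"
    by (auto simp: eventually_sequentially)
  define m where "m = max N 1"
  have tau_ge: "\<tau> n \<ge> \<tau> m" if "n \<ge> m" for n
    using that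
  proof (induction rule: dec_induct)
    case (step n)
    then have "1 < \<tau> (Suc n) / \<tau> n" using N[of n] by (auto simp: m_def zero_less_mult_iff)
    then show ?case using step tau_pos[of n] by (auto simp: m_def pos_less_divide_eq)
  qed simp
  have "filterlim Q at_top sequentially"
  proof (rule recursion_at_top[where d = "\<lambda>_. 0" and f = "g\<^sup>2 / 2 * \<tau> m"])
    have "\<forall>\<^sub>F n in sequentially. \<kappa> n > g\<^sup>2 / 2"
      by (rule order_tendstoD(1)[OF kappa_tendsto]) (use g_pos in simp)
    then show "\<forall>\<^sub>F n in sequentially. (1 - 0 / real n) * Q n + g\<^sup>2 / 2 * \<tau> m / real n \<le> Q (Suc n)"
      using eventually_ge_at_top[of m]
    proof eventually_elim
      case (elim n)
      then have n: "real n > 0" by (simp add: m_def)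
      have "g\<^sup>2 / 2 * \<tau> m \<le> \<kappa> n * \<tau> (Suc n)"
      proof (rule mult_mono)
        show "g\<^sup>2 / 2 \<le> \<kappa> n" using elim(1) by simp
        show "\<tau> m \<le> \<tau> (Suc n)" using elim(2) by (intro tau_ge) simp
        show "0 \<le> \<kappa> n" by (simp add: \<kappa>_def)
        show "0 \<le> \<tau> m" using tau_pos[of m] by (simp add: m_def less_imp_le)
      qed
      then have "g\<^sup>2 / 2 * \<tau> m / real n \<le> (a (Suc n) * \<mu> (Suc n))\<^sup>2"
        using n unfolding weight_eq_kappa[symmetric] by (simp add: pos_divide_le_eq mult.commute)
      then show ?case by (simp add: Q_Suc)
    qed
  qed (use g_pos tau_pos[of m] Q_pos in \<open>auto simp: m_def less_imp_le\<close>)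
  then have "\<forall>\<^sub>F n in sequentially. Q n > V" by (simp add: filterlim_at_top_dense)
  then obtain n where "Q n > V" using eventually_happens'[OF sequentially_bot] by blast
  with V[of n] show False by simp
qed

text \<open>The normalisers of the critical case are used without the division by \<open>Q\<close>,
  and bounds replace limits. By \<open>sup\<close> the rates \<open>1 - g * (1 - p)\<close> and
  \<open>2 * (1 - g * (1 - p))\<close> are still at least 1/2 and 1, so it remains to see that the
  sources stay bounded, which rests on a bound for \<open>\<tau>\<close>.\<close>

lemma bounded_case:
  assumes V: "\<And>n. Q n \<le> V"
  obtains b where "\<And>n. n \<ge> 1 \<Longrightarrow> (a n * \<mu> n)\<^sup>2 * C n \<le> b"
proof -
  have sup: "g * (1 - p) \<le> 1 / 2" using supercritical_of_bounded[OF V] by simp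
  have tau: "(\<lambda>n. \<tau> (Suc n)) \<in> O(\<lambda>_. 1)"
  proof -
    obtain d where d: "d \<longlonglongrightarrow> 2 * g * (1 - p) - 1"
      and r: "\<forall>\<^sub>F n in sequentially. inverse (\<tau> (Suc n)) * Q (Suc n) \<ge>
        (1 - d n / real n) * (inverse (\<tau> n) * Q n) + (g\<^sup>2 / 2) / real n"
      using Q_over_tau_recursion by blast
    have "\<forall>\<^sub>F n in sequentially. inverse (\<tau> n) * Q n > g\<^sup>2 / 4"
    \<comment> \<open>The limiting rate is at most 0, so \<open>d n\<close> is eventually below 1;
      rate 1 gives the level \<open>g\<^sup>2 / 2\<close>, above \<open>g\<^sup>2 / 4\<close>. A
      bound on \<open>Q\<close> thus becomes one on \<open>\<tau>\<close>.\<close>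
    proof (rule recursion_eventually_greater[where d = 1 and f = "g\<^sup>2 / 2"])
      have "\<forall>\<^sub>F n in sequentially. d n < 1"
        by (rule order_tendstoD(2)[OF d]) (use sup in simp)
      then show "\<forall>\<^sub>F n in sequentially. (1 - 1 / real n) * (inverse (\<tau> n) * Q n) + (g\<^sup>2 / 2) / real n \<le>
          inverse (\<tau> (Suc n)) * Q (Suc n)"
        using r eventually_ge_at_top[of 1]
      proof eventually_elim
        case (elim n)
        have "(1 - 1 / real n) * (inverse (\<tau> n) * Q n) \<le> (1 - d n / real n) * (inverse (\<tau> n) * Q n)"
          using elim tau_pos[of n] Q_pos[of n]
          by (intro mult_right_mono diff_left_mono divide_right_mono) auto
        with elim show ?case by linarith
      qed
    qed (use g_pos in auto)
    then have "\<forall>\<^sub>F n in sequentially. norm (\<tau> n) \<le> 4 * V / g\<^sup>2 * norm (1 :: real)"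
      using eventually_ge_at_top[of 1]
    proof eventually_elim
      case (elim n)
      then have "g\<^sup>2 / 4 * \<tau> n < Q n" using tau_pos[of n] by (simp add: field_simps)
      with V[of n] have "g\<^sup>2 / 4 * \<tau> n \<le> V" by linarith
      then show ?case using g_pos tau_pos[of n] elim by (simp add: field_simps)
    qed
    then have "\<tau> \<in> O(\<lambda>_. 1)" by (rule bigoI)
    then show ?thesis
      using landau_o.big.compose[OF _ filterlim_Suc] by fastforce
  qed
  have O1: "f \<in> O(\<lambda>_. 1)" if "f \<longlonglongrightarrow> l" for f :: "nat \<Rightarrow> real" and l
    using that by (intro bigoI_tendsto[where c = l]) simp_all
  have Om: "(\<lambda>n. f n * h n) \<in> O(\<lambda>_. 1)" if "f \<in> O(\<lambda>_. 1)" "h \<in> O(\<lambda>_. 1)" for f h :: "nat \<Rightarrow> real"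
    using landau_o.big.mult[OF that] by simp
  have Ob: "h \<in> O(\<lambda>_. 1)" if "\<And>n. n \<ge> 1 \<Longrightarrow> 0 \<le> h n" "\<And>n. n \<ge> 1 \<Longrightarrow> h n \<le> b" for h :: "nat \<Rightarrow> real" and b
  proof (rule bigoI)
    show "\<forall>\<^sub>F n in sequentially. norm (h n) \<le> b * norm (1 :: real)"
      using eventually_ge_at_top[of 1] by eventually_elim (use that in auto)
  qed
  have Oe: "h \<in> O(\<lambda>_. 1)" if "f \<in> O(\<lambda>_. 1)" "\<And>n. n \<ge> 1 \<Longrightarrow> f n = h n" for f h :: "nat \<Rightarrow> real"
  proof -
    have "\<forall>\<^sub>F n in sequentially. f n = h n" using eventually_ge_at_top[of 1] by eventually_elim (rule that)
    from landau_o.big.in_cong[OF this] that show ?thesis by simp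
  qed
  note quot = has_index_quotient[OF has_index_a] has_index_quotient[OF has_index_nu]
    has_index_quotient[OF has_index_u]
  have aA: "(\<lambda>n. (a n)\<^sup>2 * A n) \<in> O(\<lambda>_. 1)"
    by (rule Ob[of _ V]) (use A_nonneg weighted_A_le V in \<open>auto intro: order_trans\<close>)
  have "\<exists>b. \<forall>n\<ge>1. a n * u n * B n \<le> b"
  proof (rule scaled_recursion_bounded[OF has_index_mult[OF has_index_a has_index_u] q_mult_tendsto _ _ B_Suc B_nonneg])
    have "(\<lambda>n. p * (real n / real (Suc n)) * (a (Suc n) / a n)\<^sup>2 * (\<nu> (Suc n) / \<nu> n) * ((a n)\<^sup>2 * A n)
        + real n / real (Suc n) * ratio (Suc n) * \<tau> (Suc n)) \<in> O(\<lambda>_. 1)"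
    proof (rule sum_in_bigo(1)[OF Om[OF O1 aA] Om[OF O1 tau]])
      show "(\<lambda>n. p * (real n / real (Suc n)) * (a (Suc n) / a n)\<^sup>2 * (\<nu> (Suc n) / \<nu> n)) \<longlonglongrightarrow> p * 1 * 1\<^sup>2 * 1"
        by (intro tendsto_mult tendsto_const tendsto_power quot shift_quotient)
      show "(\<lambda>n. real n / real (Suc n) * ratio (Suc n)) \<longlonglongrightarrow> 1 * g"
        by (intro tendsto_mult shift_quotient ratio_Suc_tendsto)
    qed
    then show "(\<lambda>n. real n * (a (Suc n) * u (Suc n)) * (p * A n / \<nu> n + \<mu> (Suc n))) \<in> O(\<lambda>_. 1)"
    proof (rule Oe)
      fix n :: nat assume "n \<ge> 1"
      then show "p * (real n / real (Suc n)) * (a (Suc n) / a n)\<^sup>2 * (\<nu> (Suc n) / \<nu> n) * ((a n)\<^sup>2 * A n)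
          + real n / real (Suc n) * ratio (Suc n) * \<tau> (Suc n) =
          real n * (a (Suc n) * u (Suc n)) * (p * A n / \<nu> n + \<mu> (Suc n))"
        using a_pos[of n] nu_pos[of n] nu_pos[of "Suc n"]
        by (simp add: \<tau>_def u_def ratio_def power2_eq_square field_simps del: of_nat_Suc)
    qed
    show "- (p * g) + (g * (1 - p) - 1) + p * g < 0" using sup by simp
  qed
  then obtain bB where bB: "\<And>n. n \<ge> 1 \<Longrightarrow> a n * u n * B n \<le> bB" by blast
  have aB: "(\<lambda>n. a n * u n * B n) \<in> O(\<lambda>_. 1)"
    by (rule Ob[OF _ bB]) (use a_pos u_pos B_nonneg in \<open>auto simp: less_imp_le\<close>)
  have "\<exists>b. \<forall>n\<ge>1. (u n)\<^sup>2 * C n \<le> b"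
  proof (rule scaled_recursion_bounded[OF has_index_power2[OF has_index_u], of "\<lambda>_. 0" 0 "\<lambda>n. 2 * p * B n / \<nu> n + 1" C])
    have "(\<lambda>n. 2 * p * (real n / real (Suc n)) * (a (Suc n) / a n) * (\<nu> (Suc n) / \<nu> n) * (u (Suc n) / u n) * (a n * u n * B n)
        + real n / real (Suc n) * \<tau> (Suc n)) \<in> O(\<lambda>_. 1)"
    proof (rule sum_in_bigo(1)[OF Om[OF O1 aB] Om[OF O1 tau]])
      show "(\<lambda>n. 2 * p * (real n / real (Suc n)) * (a (Suc n) / a n) * (\<nu> (Suc n) / \<nu> n) * (u (Suc n) / u n))
          \<longlonglongrightarrow> 2 * p * 1 * 1 * 1 * 1"
        by (intro tendsto_mult tendsto_const quot shift_quotient)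
    qed (rule shift_quotient)
    then show "(\<lambda>n. real n * (u (Suc n))\<^sup>2 * (2 * p * B n / \<nu> n + 1)) \<in> O(\<lambda>_. 1)"
    proof (rule Oe)
      fix n :: nat assume "n \<ge> 1"
      then show "2 * p * (real n / real (Suc n)) * (a (Suc n) / a n) * (\<nu> (Suc n) / \<nu> n) * (u (Suc n) / u n) * (a n * u n * B n)
          + real n / real (Suc n) * \<tau> (Suc n) =
          real n * (u (Suc n))\<^sup>2 * (2 * p * B n / \<nu> n + 1)"
        using a_pos[of n] nu_pos[of n]
        by (simp add: \<tau>_def u_def power2_eq_square field_simps del: of_nat_Suc)
    qed
    show "2 * (g * (1 - p) - 1) + 0 < 0" using sup by simp
    show "C (Suc n) = (1 + 0) * C n + (2 * p * B n / \<nu> n + 1)" if "n \<ge> 1" for n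
      using C_Suc[OF that] by simp
    show "(\<lambda>n. real n * 0) \<longlonglongrightarrow> 0" by simp
  qed (rule C_nonneg)
  then obtain bC where bC: "\<And>n. n \<ge> 1 \<Longrightarrow> (u n)\<^sup>2 * C n \<le> bC" by blast
  obtain R where R: "R > 0" "\<And>n. n \<ge> 1 \<Longrightarrow> ratio n \<le> R" using ratio_bounded by blast
  show ?thesis
  proof (rule that)
    fix n :: nat assume n: "n \<ge> 1"
    have "(a n * \<mu> n)\<^sup>2 * C n = (ratio n)\<^sup>2 * ((u n)\<^sup>2 * C n)"
      by (simp add: weight_eq[OF n] power_mult_distrib)
    also have "\<dots> \<le> R\<^sup>2 * bC"
      using R ratio_pos[OF n] bC[OF n] C_nonneg[OF n] n by (intro mult_mono power_mono) auto
    finally show "(a n * \<mu> n)\<^sup>2 * C n \<le> R\<^sup>2 * bC" .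
  qed
qed

section \<open>Translation to \<open>vseq\<close>, \<open>sigma\<close> and
  \<open>p_crit\<close>\<close>

lemma vseq_eq: "vseq p \<mu> n = sqrt (Q n)"
  by (simp add: vseq_def Q_def)

lemma Q_nonneg: "Q n \<ge> 0"
  unfolding Q_def by (intro sum_nonneg) auto

lemma bounded_vseq_iff: "bounded (range (vseq p \<mu>)) \<longleftrightarrow> (\<exists>V. \<forall>n. Q n \<le> V)"
proof
  assume "bounded (range (vseq p \<mu>))"
  then obtain c where "\<And>n. sqrt (Q n) \<le> c"
    by (auto simp: bounded_iff vseq_eq Q_nonneg)
  then have "Q n \<le> c\<^sup>2" for n
    using Q_nonneg[of n] by (metis real_sqrt_ge_zero real_sqrt_pow2 power_mono)
  then show "\<exists>V. \<forall>n. Q n \<le> V" by blast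
next
  assume "\<exists>V. \<forall>n. Q n \<le> V"
  then obtain V where "\<And>n. Q n \<le> V" by blast
  then have "norm (vseq p \<mu> n) \<le> sqrt V" for n
    by (simp add: vseq_eq Q_nonneg)
  then show "bounded (range (vseq p \<mu>))" by (auto simp: bounded_iff)
qed

lemma Q_at_top:
  assumes "\<not> bounded (range (vseq p \<mu>))"
  shows "filterlim Q at_top sequentially"
  unfolding filterlim_at_top_dense
proof
  fix z
  obtain m where m: "z < Q m"
    using assms by (auto simp: bounded_vseq_iff not_le)
  show "\<forall>\<^sub>F n in sequentially. z < Q n"
    using eventually_ge_at_top[of m] by eventually_elim (use m Q_mono in \<open>force intro: less_le_trans\<close>)
qed

lemma p_crit_eq: "p_crit \<gamma> = (2 * g - 1) / (2 * g)"
  using g_pos by (simp add: p_crit_def g_def field_simps)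

lemma less_p_crit_iff: "p < p_crit \<gamma> \<longleftrightarrow> 2 * g * (1 - p) > 1"
  using g_pos by (auto simp: p_crit_eq pos_less_divide_eq algebra_simps)

lemma eq_p_crit_iff: "p = p_crit \<gamma> \<longleftrightarrow> 2 * g * (1 - p) = 1"
  using g_pos by (auto simp: p_crit_eq field_simps)

lemma subcritical_asymp:
  assumes "p < p_crit \<gamma>"
  shows "C \<sim>[at_top] (\<lambda>n. (2 * \<gamma> + 1 - p) / ((1 - p) * (2 * (1 - p) * (\<gamma> + 1) - 1)) * real n)"
proof (rule asymp_equiv_const_multI)
  have sub: "2 * g * (1 - p) > 1" using assms by (simp only: less_p_crit_iff)
  have p1: "p < 1" using sub p_range by (cases "p = 1") auto
  define d where "d = 2 * g * (1 - p) - 1"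
  have d: "d > 0" using sub by (simp add: d_def)
  have d': "2 * (1 - p) * (\<gamma> + 1) - 1 = d" by (simp add: d_def g_def algebra_simps)
  have "1 + 2 * p * ((p * (g\<^sup>2 / d) + g) / (g * (1 - p))) = 1 + 2 * p * ((p * g / d + 1) / (1 - p))"
    using g_pos p1 by (simp add: field_simps power2_eq_square)
  also have "\<dots> = ((1 + p) * d + 2 * p\<^sup>2 * g) / ((1 - p) * d)"
    using d p1 by (simp add: field_simps power2_eq_square)
  \<comment> \<open>The terms in \<open>p\<^sup>2 * g\<close> cancel and leave
    \<open>2 * g - 1 - p\<close>. The left side shows in addition that this number is
    positive.\<close>
  also have "(1 + p) * d + 2 * p\<^sup>2 * g = 2 * \<gamma> + 1 - p"
    by (simp add: d_def g_def power2_eq_square algebra_simps)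
  finally show "(\<lambda>n. C n / real n) \<longlonglongrightarrow> (2 * \<gamma> + 1 - p) / ((1 - p) * (2 * (1 - p) * (\<gamma> + 1) - 1))"
    using subcritical[OF sub] unfolding d' d_def[symmetric] by simp
  have "0 < (1 + p) * d + 2 * p\<^sup>2 * g"
    using d p_range g_pos by (intro add_pos_nonneg mult_pos_pos) auto
  then have "2 * \<gamma> + 1 - p > 0"
    using \<open>(1 + p) * d + 2 * p\<^sup>2 * g = 2 * \<gamma> + 1 - p\<close> by simp
  then show "(2 * \<gamma> + 1 - p) / ((1 - p) * (2 * (1 - p) * (\<gamma> + 1) - 1)) \<noteq> 0"
    unfolding d' using d p1 by simp
qed

text \<open>From \<open>2 * g * (1 - p) = 1\<close> follows
  \<open>2 * g * p = 2 * \<gamma> + 1\<close>, which identifies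
  \<open>g\<^sup>2 * (4 * p\<^sup>2)\<close> with the constant. The quotient form also covers the
  constant 0.\<close>

lemma critical_limit:
  assumes crit: "p = p_crit \<gamma>" and unb: "\<not> bounded (range (vseq p \<mu>))"
  shows "(\<lambda>n. C n / (sigma p \<mu> n)\<^sup>2) \<longlonglongrightarrow> (2 * \<gamma> + 1)\<^sup>2"
proof -
  have eq: "2 * g * (1 - p) = 1" using crit by (simp only: eq_p_crit_iff)
  have "(\<lambda>n. (ratio n)\<^sup>2 * ((u n)\<^sup>2 / Q n * C n)) \<longlonglongrightarrow> g\<^sup>2 * (4 * p\<^sup>2)"
    unfolding g_def by (intro tendsto_mult tendsto_power ratio_tendsto critical[OF eq Q_at_top[OF unb]])
  also have "g\<^sup>2 * (4 * p\<^sup>2) = (2 * g * p)\<^sup>2" by (simp add: power_mult_distrib)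
  also have "2 * g * p = 2 * \<gamma> + 1"
    using eq by (simp add: g_def algebra_simps)
  finally show ?thesis
  proof (rule Lim_transform_eventually)
    show "\<forall>\<^sub>F n in sequentially. (ratio n)\<^sup>2 * ((u n)\<^sup>2 / Q n * C n) = C n / (sigma p \<mu> n)\<^sup>2"
      using eventually_ge_at_top[of 1]
    proof eventually_elim
      case (elim n)
      have "(sigma p \<mu> n)\<^sup>2 = Q n / (ratio n * u n)\<^sup>2"
        by (simp add: sigma_def vseq_eq power_divide Q_nonneg weight_eq[OF elim, symmetric])
      then show ?case by (simp add: power_mult_distrib)
    qed
  qed
qed

end

section \<open>The moments of the walk as an instance\<close>

lemma (in srrw_L2) rv_moments_mom:
  "rv_moments \<gamma> \<mu> p (mom \<mu> \<mu>) (mom \<mu> (\<lambda>_. 1)) (mom (\<lambda>_. 1) (\<lambda>_. 1))"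
proof unfold_locales
  show "\<gamma> > -1" "regularly_varying \<gamma> \<mu>" "0 \<le> p" "p \<le> 1"
    by (rule gamma_gt mu_rv p_range)+
  show "\<mu> n > 0" if "n \<ge> 1" for n
    by (rule mu_pos[OF that])
  show "mom \<mu> \<mu> 1 = (\<mu> 1)\<^sup>2" "mom \<mu> (\<lambda>_. 1) 1 = \<mu> 1" "mom (\<lambda>_. 1) (\<lambda>_. 1) 1 = 1"
    unfolding mom_1 by (simp_all add: power2_eq_square)
  fix n :: nat assume "n \<ge> 1"
  note S = mom_Suc[OF this]
  show "mom \<mu> \<mu> (Suc n) = (1 + 2 * p * (\<mu> (Suc n) / nu \<mu> n)) * mom \<mu> \<mu> n + (\<mu> (Suc n))\<^sup>2"
    unfolding S[of \<mu> \<mu>] by (simp add: algebra_simps power2_eq_square)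
  show "mom \<mu> (\<lambda>_. 1) (Suc n) = (1 + p * (\<mu> (Suc n) / nu \<mu> n)) * mom \<mu> (\<lambda>_. 1) n +
      (p * mom \<mu> \<mu> n / nu \<mu> n + \<mu> (Suc n))"
    unfolding S[of \<mu> "\<lambda>_. 1"] by (simp add: algebra_simps)
  show "mom (\<lambda>_. 1) (\<lambda>_. 1) (Suc n) = mom (\<lambda>_. 1) (\<lambda>_. 1) n + (2 * p * mom \<mu> (\<lambda>_. 1) n / nu \<mu> n + 1)"
    unfolding S[of "\<lambda>_. 1" "\<lambda>_. 1"] by (simp add: algebra_simps)
qed

text \<open>For \<open>\<gamma> = -1/2\<close> the critical value is 0 and so is the constant, while
  the second moment of the walk is then \<open>n\<close>. Equivalence with the zero sequence would
  be false, and convergence of the quotient to 0 takes its place. In the bounded case the integrals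
  are nonnegative integrals, so a finite supremum includes finiteness of each second moment.\<close>

theorem theorem2p3:
  fixes M :: "'a measure" and p \<gamma> :: real and \<mu> :: "nat \<Rightarrow> real"
    and \<xi> :: "nat \<Rightarrow> 'a \<Rightarrow> real" and \<alpha> :: "nat \<Rightarrow> 'a \<Rightarrow> bool" and \<beta> :: "nat \<Rightarrow> 'a \<Rightarrow> nat"
  assumes "srrw_rvm M p \<gamma> \<mu> \<xi> \<alpha> \<beta>"
    and "integrable M (\<lambda>\<omega>. (\<xi> 1 \<omega>)\<^sup>2)"
    and "(\<integral>\<omega>. (\<xi> 1 \<omega>)\<^sup>2 \<partial>M) = 1"
  shows
    "(\<not> bounded (range (vseq p \<mu>)) \<longrightarrow>
        (p < p_crit \<gamma> \<longrightarrow>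
          (\<lambda>n. \<integral>\<omega>. (walk \<xi> \<alpha> \<beta> n \<omega>)\<^sup>2 \<partial>M) \<sim>[at_top]
          (\<lambda>n. (2 * \<gamma> + 1 - p) / ((1 - p) * (2 * (1 - p) * (\<gamma> + 1) - 1)) * real n)) \<and>
        (p = p_crit \<gamma> \<and> \<gamma> \<noteq> -1/2 \<longrightarrow>
          (\<lambda>n. \<integral>\<omega>. (walk \<xi> \<alpha> \<beta> n \<omega>)\<^sup>2 \<partial>M) \<sim>[at_top]
          (\<lambda>n. (2 * \<gamma> + 1)\<^sup>2 * (sigma p \<mu> n)\<^sup>2)) \<and>
        (p = p_crit \<gamma> \<and> \<gamma> = -1/2 \<longrightarrow>
          (\<lambda>n. (\<integral>\<omega>. (walk \<xi> \<alpha> \<beta> n \<omega>)\<^sup>2 \<partial>M) / (sigma p \<mu> n)\<^sup>2) \<longlonglongrightarrow> (2 * \<gamma> + 1)\<^sup>2)) \<and>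
     (bounded (range (vseq p \<mu>)) \<longrightarrow>
        (SUP n\<in>{1..}. \<integral>\<^sup>+\<omega>. ennreal ((aseq p \<mu> n)\<^sup>2 * (\<mu> n)\<^sup>2 * (walk \<xi> \<alpha> \<beta> n \<omega>)\<^sup>2) \<partial>M) < \<infinity>)"
proof -
  interpret W: srrw_L2 M p \<gamma> \<mu> \<xi> \<alpha> \<beta>
    by (intro srrw_L2.intro srrw_L2_axioms.intro assms)
  let ?C = "W.mom (\<lambda>_. 1) (\<lambda>_. 1)"
  interpret R: rv_moments \<gamma> \<mu> p "W.mom \<mu> \<mu>" "W.mom \<mu> (\<lambda>_. 1)" ?C
    by (rule W.rv_moments_mom)
  have C: "(\<integral>\<omega>. (walk \<xi> \<alpha> \<beta> n \<omega>)\<^sup>2 \<partial>M) = ?C n" for n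
    by (simp add: W.mom_def W.walk_eq_comb power2_eq_square)
  have crit: "?C \<sim>[at_top] (\<lambda>n. (2 * \<gamma> + 1)\<^sup>2 * (sigma p \<mu> n)\<^sup>2)"
    if "\<not> bounded (range (vseq p \<mu>))" "p = p_crit \<gamma>" "\<gamma> \<noteq> -1/2"
    using that(3) by (intro asymp_equiv_const_multI R.critical_limit that) auto
  have bdd: "(SUP n\<in>{1..}. \<integral>\<^sup>+\<omega>. ennreal ((aseq p \<mu> n)\<^sup>2 * (\<mu> n)\<^sup>2 * (walk \<xi> \<alpha> \<beta> n \<omega>)\<^sup>2) \<partial>M) < \<infinity>"
    if bounded: "bounded (range (vseq p \<mu>))"
  proof -
    obtain V where "\<And>n. R.Q n \<le> V" using bounded R.bounded_vseq_iff by blast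
    then obtain b where b: "\<And>n. n \<ge> 1 \<Longrightarrow> (aseq p \<mu> n * \<mu> n)\<^sup>2 * ?C n \<le> b"
      using R.bounded_case by blast
    have "(\<integral>\<^sup>+\<omega>. ennreal ((aseq p \<mu> n)\<^sup>2 * (\<mu> n)\<^sup>2 * (walk \<xi> \<alpha> \<beta> n \<omega>)\<^sup>2) \<partial>M) \<le> ennreal b" if "n \<ge> 1" for n
    proof -
      have "integrable M (\<lambda>\<omega>. (walk \<xi> \<alpha> \<beta> n \<omega>)\<^sup>2)"
        using W.integrable_comb_mult_comb by (simp add: W.walk_eq_comb power2_eq_square)
      then have "(\<integral>\<^sup>+\<omega>. ennreal ((aseq p \<mu> n)\<^sup>2 * (\<mu> n)\<^sup>2 * (walk \<xi> \<alpha> \<beta> n \<omega>)\<^sup>2) \<partial>M) =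
          ennreal (\<integral>\<omega>. (aseq p \<mu> n)\<^sup>2 * (\<mu> n)\<^sup>2 * (walk \<xi> \<alpha> \<beta> n \<omega>)\<^sup>2 \<partial>M)"
        by (intro nn_integral_eq_integral) auto
      also have "\<dots> = ennreal ((aseq p \<mu> n * \<mu> n)\<^sup>2 * ?C n)"
        by (simp add: C power_mult_distrib)
      also have "\<dots> \<le> ennreal b"
        using b[OF that] by (rule ennreal_leI)
      finally show ?thesis .
    qed
    then have "(SUP n\<in>{1..}. \<integral>\<^sup>+\<omega>. ennreal ((aseq p \<mu> n)\<^sup>2 * (\<mu> n)\<^sup>2 * (walk \<xi> \<alpha> \<beta> n \<omega>)\<^sup>2) \<partial>M) \<le> ennreal b"
      by (intro SUP_least) auto
    then show ?thesis by (rule le_less_trans) simp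
  qed
  show ?thesis
    unfolding C using R.subcritical_asymp R.critical_limit crit bdd by blast
qed

end
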